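(* $\mathrm{WKL}_0\nvdash\mathrm{FinCOH}$; that is, the finite cohesiveness principle $\mathrm{FinCOH}$ is not provable in $\mathrm{WKL}_0$ (equivalently, there is a model of $\mathrm{WKL}_0$ in which $\mathrm{FinCOH}$ fails).
   Context: We work in the two-sorted language of second-order arithmetic (numbers and sets); a model is a pair $(M,\mathcal{X})$ with $M$ the first-order part and $\mathcal{X}$ a family of subsets of $M$. $\mathbb{N}$ denotes the set of all numbers as formalized inside the theory (interpreted as $M$). $\Sigma^0_n,\Pi^0_n$ are the usual classes of formulas counted by alternating blocks of first-order quantifiers, with first- and second-order parameters allowed and no second-order quantifiers; $\Delta^0_n$ means given by both a $\Sigma^0_n$ and a $\Pi^0_n$ formula. $\mathrm{RCA}_0$ consists of Robinson arithmetic, the induction scheme $\mathrm{I}\Sigma^0_1$ for $\Sigma^0_1$ formulas, and comprehension for $\Delta^0_1$ formulas. $\mathrm{WKL}_0$ is $\mathrm{RCA}_0$ plus the axiom that every infinite binary tree has an infinite path. $A\subseteq^* B$ means $\exists b\,\forall x>b\,(x\in A\to x\in B)$. $A^c$ is the complement of $A$. A set is infinite if it is unbounded in $\mathbb{N}$. With a standard pairing function $\langle\cdot,\cdot\rangle$, a set $R$ is viewed as a sequence of sets by $R_k=\{x : \langle k,x\rangle\in R\}$. $\mathrm{FinCOH}$ (finite cohesiveness principle): for every $\ell\in\mathbb{N}$ and every sequence of sets $R=(R_k)_{k<\ell}$ of length $\ell$, there is an infinite set $H$ such that for every $k<\ell$, either $H\subseteq^* R_k$ or $H\subseteq^* R_k^c$.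 (Here $\ell$ ranges over all, possibly nonstandard, numbers of the model.) *)

theory Defs
  imports Main
begin

section \<open>Syntax of second-order arithmetic\<close>

text \<open>
  Variables are de Bruijn indices, with two independent index spaces: \<open>Var i\<close> is the
  \<open>i\<close>-th number variable, and in \<open>Mem t j\<close> the index \<open>j\<close> is the \<open>j\<close>-th set variable.
  \<open>Forall\<close> binds number variable \<open>0\<close> and leaves set indices alone; \<open>ForallS\<close> binds set
  variable \<open>0\<close> and leaves number indices alone. As usual in this language, equality is
  primitive only between numbers.
\<close>

datatype tm = Var nat | Zero | Succ tm | Add tm tm | Mul tm tm

datatype fm =
    Bot
  | Eq tm tm
  | Less tm tm
  | Mem tm nat
  | Imp fm fm
  | Forall fm
  | ForallS fm

definition Neg :: "fm \<Rightarrow> fm" where "Neg \<phi> = Imp \<phi> Bot"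
definition Conj :: "fm \<Rightarrow> fm \<Rightarrow> fm" where "Conj \<phi> \<psi> = Neg (Imp \<phi> (Neg \<psi>))"
definition Disj :: "fm \<Rightarrow> fm \<Rightarrow> fm" where "Disj \<phi> \<psi> = Imp (Neg \<phi>) \<psi>"
definition Iff :: "fm \<Rightarrow> fm \<Rightarrow> fm" where "Iff \<phi> \<psi> = Conj (Imp \<phi> \<psi>) (Imp \<psi> \<phi>)"
definition Exists :: "fm \<Rightarrow> fm" where "Exists \<phi> = Neg (Forall (Neg \<phi>))"
definition ExistsS :: "fm \<Rightarrow> fm" where "ExistsS \<phi> = Neg (ForallS (Neg \<phi>))"

primrec sub_tm :: "(nat \<Rightarrow> tm) \<Rightarrow> tm \<Rightarrow> tm" where
  "sub_tm \<sigma> (Var i) = \<sigma> i"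
| "sub_tm \<sigma> Zero = Zero"
| "sub_tm \<sigma> (Succ t) = Succ (sub_tm \<sigma> t)"
| "sub_tm \<sigma> (Add t u) = Add (sub_tm \<sigma> t) (sub_tm \<sigma> u)"
| "sub_tm \<sigma> (Mul t u) = Mul (sub_tm \<sigma> t) (sub_tm \<sigma> u)"

abbreviation lift_tm :: "tm \<Rightarrow> tm" where "lift_tm \<equiv> sub_tm (\<lambda>i. Var (Suc i))"

text \<open>
  Simultaneous capture-avoiding substitution of terms for number variables (\<open>\<sigma>\<close>) and of
  set variables for set variables (\<open>\<rho>\<close>).
\<close>

primrec sub :: "(nat \<Rightarrow> tm) \<Rightarrow> (nat \<Rightarrow> nat) \<Rightarrow> fm \<Rightarrow> fm" where
  "sub \<sigma> \<rho> Bot = Bot"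
| "sub \<sigma> \<rho> (Eq t u) = Eq (sub_tm \<sigma> t) (sub_tm \<sigma> u)"
| "sub \<sigma> \<rho> (Less t u) = Less (sub_tm \<sigma> t) (sub_tm \<sigma> u)"
| "sub \<sigma> \<rho> (Mem t j) = Mem (sub_tm \<sigma> t) (\<rho> j)"
| "sub \<sigma> \<rho> (Imp \<phi> \<psi>) = Imp (sub \<sigma> \<rho> \<phi>) (sub \<sigma> \<rho> \<psi>)"
| "sub \<sigma> \<rho> (Forall \<phi>) = Forall (sub (case_nat (Var 0) (\<lambda>i. lift_tm (\<sigma> i))) \<rho> \<phi>)"
| "sub \<sigma> \<rho> (ForallS \<phi>) = ForallS (sub \<sigma> (case_nat 0 (\<lambda>j. Suc (\<rho> j))) \<phi>)"

abbreviation lift :: "fm \<Rightarrow> fm" where "lift \<equiv> sub (\<lambda>i. Var (Suc i)) id"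
abbreviation liftS :: "fm \<Rightarrow> fm" where "liftS \<equiv> sub Var Suc"
abbreviation inst :: "fm \<Rightarrow> tm \<Rightarrow> fm" where "inst \<phi> t \<equiv> sub (case_nat t Var) id \<phi>"
abbreviation instS :: "fm \<Rightarrow> nat \<Rightarrow> fm" where "instS \<phi> j \<equiv> sub Var (case_nat j id) \<phi>"

section \<open>The arithmetical hierarchy\<close>

text \<open>
  Number and set variables may occur free as parameters. The bound of a bounded quantifier
  does not contain the bound variable, hence \<open>lift_tm\<close>.
\<close>

inductive Delta00 :: "fm \<Rightarrow> bool" where
  "Delta00 Bot"
| "Delta00 (Eq t u)"
| "Delta00 (Less t u)"
| "Delta00 (Mem t j)"
| "Delta00 \<phi> \<Longrightarrow> Delta00 \<psi> \<Longrightarrow> Delta00 (Imp \<phi> \<psi>)"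
| "Delta00 \<phi> \<Longrightarrow> Delta00 (Forall (Imp (Less (Var 0) (lift_tm t)) \<phi>))"
| "Delta00 \<phi> \<Longrightarrow> Delta00 (Exists (Conj (Less (Var 0) (lift_tm t)) \<phi>))"

inductive Sigma0 :: "nat \<Rightarrow> fm \<Rightarrow> bool" and Pi0 :: "nat \<Rightarrow> fm \<Rightarrow> bool" where
  "Delta00 \<phi> \<Longrightarrow> Sigma0 0 \<phi>"
| "Delta00 \<phi> \<Longrightarrow> Pi0 0 \<phi>"
| "Pi0 n \<phi> \<Longrightarrow> Sigma0 (Suc n) \<phi>"
| "Sigma0 (Suc n) \<phi> \<Longrightarrow> Sigma0 (Suc n) (Exists \<phi>)"
| "Sigma0 n \<phi> \<Longrightarrow> Pi0 (Suc n) \<phi>"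
| "Pi0 (Suc n) \<phi> \<Longrightarrow> Pi0 (Suc n) (Forall \<phi>)"

section \<open>The theories\<close>

text \<open>
  Axioms with free variables stand for their universal closures; both derivability and
  validity below treat them so.
\<close>

definition robinson :: "fm set" where
  "robinson =
    {Neg (Eq (Succ (Var 0)) Zero),
     Imp (Eq (Succ (Var 0)) (Succ (Var 1))) (Eq (Var 0) (Var 1)),
     Disj (Eq (Var 0) Zero) (Exists (Eq (Var 1) (Succ (Var 0)))),
     Eq (Add (Var 0) Zero) (Var 0),
     Eq (Add (Var 0) (Succ (Var 1))) (Succ (Add (Var 0) (Var 1))),
     Eq (Mul (Var 0) Zero) Zero,
     Eq (Mul (Var 0) (Succ (Var 1))) (Add (Mul (Var 0) (Var 1)) (Var 0)),
     Iff (Less (Var 0) (Var 1)) (Exists (Eq (Add (Var 0) (Succ (Var 1))) (Var 2)))}"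

definition induction_ax :: "fm \<Rightarrow> fm" where
  "induction_ax \<phi> =
    Imp (inst \<phi> Zero)
      (Imp (Forall (Imp \<phi> (sub (case_nat (Succ (Var 0)) (\<lambda>i. Var (Suc i))) id \<phi>)))
        (Forall \<phi>))"

definition delta_comprehension_ax :: "fm \<Rightarrow> fm \<Rightarrow> fm" where
  "delta_comprehension_ax \<phi> \<psi> =
    Imp (Forall (Iff \<phi> \<psi>)) (ExistsS (Forall (Iff (Mem (Var 0) 0) (liftS \<phi>))))"

definition RCA0 :: "fm set" where
  "RCA0 = robinson
     \<union> {induction_ax \<phi> | \<phi>. Sigma0 1 \<phi>}
     \<union> {delta_comprehension_ax \<phi> \<psi> | \<phi> \<psi>. Sigma0 1 \<phi> \<and> Pi0 1 \<psi>}"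

text \<open>The pairing function \<open>\<langle>x, y\<rangle> = (x + y)\<^sup>2 + x\<close>, which is a term of the language.\<close>

definition pair_tm :: "tm \<Rightarrow> tm \<Rightarrow> tm" where
  "pair_tm t u = Add (Mul (Add t u) (Add t u)) t"

definition infinite_fm :: "nat \<Rightarrow> fm" where
  "infinite_fm X = Forall (Exists (Conj (Less (Var 1) (Var 0)) (Mem (Var 0) X)))"

text \<open>
  Finite binary strings are coded by numbers through bijective base-2 numeration: the empty
  string has code \<open>0\<close>, and if \<open>\<sigma>\<close> has code \<open>s\<close> then \<open>\<sigma>0\<close> has code \<open>2 s + 1\<close> and \<open>\<sigma>1\<close> has
  code \<open>2 s + 2\<close>. Every number is the code of exactly one string, so a binary tree is a set
  of numbers closed under passing from the code of \<open>\<sigma>0\<close> or \<open>\<sigma>1\<close> to the code of \<open>\<sigma>\<close>.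
\<close>

abbreviation snoc0 :: "tm \<Rightarrow> tm" where "snoc0 t \<equiv> Succ (Add t t)"
abbreviation snoc1 :: "tm \<Rightarrow> tm" where "snoc1 t \<equiv> Succ (Succ (Add t t))"

definition tree_fm :: "nat \<Rightarrow> fm" where
  "tree_fm T =
    Forall (Imp (Disj (Mem (snoc0 (Var 0)) T) (Mem (snoc1 (Var 0)) T)) (Mem (Var 0) T))"

text \<open>
  \<open>initial_segments_fm X P\<close> says that \<open>P = {\<langle>n, s\<rangle>. s is the code of X restricted to n}\<close>, where
  \<open>X\<close> is identified with its characteristic function, by recursion on \<open>n\<close>. (Only the pairs
  in \<open>P\<close> matter; the pairing function is not surjective.)
\<close>

definition initial_segments_fm :: "nat \<Rightarrow> nat \<Rightarrow> fm" where
  "initial_segments_fm X P =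
    Conj
      (Forall (Iff (Mem (pair_tm Zero (Var 0)) P) (Eq (Var 0) Zero)))
      (Forall (Forall
        (Iff (Mem (pair_tm (Succ (Var 1)) (Var 0)) P)
          (Exists (Conj (Mem (pair_tm (Var 2) (Var 0)) P)
            (Disj (Conj (Neg (Mem (Var 2) X)) (Eq (Var 1) (snoc0 (Var 0))))
                  (Conj (Mem (Var 2) X) (Eq (Var 1) (snoc1 (Var 0))))))))))"

text \<open>\<open>X\<close> is an infinite path through \<open>T\<close>: every finite initial segment of \<open>X\<close> belongs to \<open>T\<close>.\<close>

definition path_fm :: "nat \<Rightarrow> nat \<Rightarrow> fm" where
  "path_fm T X =
    ExistsS (Conj (initial_segments_fm (Suc X) 0)
      (Forall (Forall (Imp (Mem (pair_tm (Var 1) (Var 0)) 0) (Mem (Var 0) (Suc T))))))"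

definition WKL :: fm where
  "WKL = ForallS (Imp (Conj (tree_fm 0) (infinite_fm 0)) (ExistsS (path_fm 1 0)))"

definition WKL0 :: "fm set" where
  "WKL0 = RCA0 \<union> {WKL}"

text \<open>
  In the innermost scope, \<open>x, b, k, \<ell>\<close> are the number variables \<open>0, 1, 2, 3\<close>, and \<open>H, R\<close> are the
  set variables \<open>0, 1\<close>. A sequence of length \<open>\<ell>\<close> is given by a set \<open>R\<close> of which only the
  sections \<open>R\<^sub>k\<close> with \<open>k < \<ell>\<close> are used.
\<close>

definition FinCOH :: fm where
  "FinCOH =
    Forall (ForallS (ExistsS (Conj (infinite_fm 0)
      (Forall (Imp (Less (Var 0) (Var 1))
        (Disj
          (Exists (Forall (Imp (Less (Var 1) (Var 0))
            (Imp (Mem (Var 0) 0) (Mem (pair_tm (Var 2) (Var 0)) 1)))))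
          (Exists (Forall (Imp (Less (Var 1) (Var 0))
            (Imp (Mem (Var 0) 0) (Neg (Mem (pair_tm (Var 2) (Var 0)) 1))))))))))))"

section \<open>Provability\<close>

text \<open>
  A Hilbert calculus for classical two-sorted first-order logic with equality on numbers.
\<close>

inductive derivable :: "fm set \<Rightarrow> fm \<Rightarrow> bool" (infix \<open>\<turnstile>\<close> 50) for \<Gamma> :: "fm set" where
  assumption: "\<phi> \<in> \<Gamma> \<Longrightarrow> \<Gamma> \<turnstile> \<phi>"
| K: "\<Gamma> \<turnstile> Imp \<phi> (Imp \<psi> \<phi>)"
| S: "\<Gamma> \<turnstile> Imp (Imp \<phi> (Imp \<psi> \<chi>)) (Imp (Imp \<phi> \<psi>) (Imp \<phi> \<chi>))"
| double_negation: "\<Gamma> \<turnstile> Imp (Neg (Neg \<phi>)) \<phi>"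
| specialize: "\<Gamma> \<turnstile> Imp (Forall \<phi>) (inst \<phi> t)"
| distribute: "\<Gamma> \<turnstile> Imp (Forall (Imp (lift \<phi>) \<psi>)) (Imp \<phi> (Forall \<psi>))"
| specializeS: "\<Gamma> \<turnstile> Imp (ForallS \<phi>) (instS \<phi> j)"
| distributeS: "\<Gamma> \<turnstile> Imp (ForallS (Imp (liftS \<phi>) \<psi>)) (Imp \<phi> (ForallS \<psi>))"
| reflexivity: "\<Gamma> \<turnstile> Eq t t"
| leibniz: "\<Gamma> \<turnstile> Imp (Eq t u) (Imp (inst \<phi> t) (inst \<phi> u))"
| modus_ponens: "\<Gamma> \<turnstile> Imp \<phi> \<psi> \<Longrightarrow> \<Gamma> \<turnstile> \<phi> \<Longrightarrow> \<Gamma> \<turnstile> \<psi>"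
| generalize: "\<Gamma> \<turnstile> \<phi> \<Longrightarrow> \<Gamma> \<turnstile> Forall \<phi>"
| generalizeS: "\<Gamma> \<turnstile> \<phi> \<Longrightarrow> \<Gamma> \<turnstile> ForallS \<phi>"

section \<open>Models\<close>

text \<open>
  The first-order part of a structure is the whole type \<open>'a\<close>; the second-order part is an
  arbitrary family of subsets. By the downward Loewenheim-Skolem theorem a theory containing
  Robinson arithmetic has a model iff it has one with \<open>'a = nat\<close>.
\<close>

record 'a l2_structure =
  zero :: 'a
  succ :: "'a \<Rightarrow> 'a"
  add :: "'a \<Rightarrow> 'a \<Rightarrow> 'a"
  mul :: "'a \<Rightarrow> 'a \<Rightarrow> 'a"
  lt :: "'a \<Rightarrow> 'a \<Rightarrow> bool"
  sets :: "'a set set"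

primrec eval_tm :: "'a l2_structure \<Rightarrow> (nat \<Rightarrow> 'a) \<Rightarrow> tm \<Rightarrow> 'a" where
  "eval_tm M e (Var i) = e i"
| "eval_tm M e Zero = zero M"
| "eval_tm M e (Succ t) = succ M (eval_tm M e t)"
| "eval_tm M e (Add t u) = add M (eval_tm M e t) (eval_tm M e u)"
| "eval_tm M e (Mul t u) = mul M (eval_tm M e t) (eval_tm M e u)"

primrec sat :: "'a l2_structure \<Rightarrow> (nat \<Rightarrow> 'a) \<Rightarrow> (nat \<Rightarrow> 'a set) \<Rightarrow> fm \<Rightarrow> bool" where
  "sat M e E Bot \<longleftrightarrow> False"
| "sat M e E (Eq t u) \<longleftrightarrow> eval_tm M e t = eval_tm M e u"
| "sat M e E (Less t u) \<longleftrightarrow> lt M (eval_tm M e t) (eval_tm M e u)"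
| "sat M e E (Mem t j) \<longleftrightarrow> eval_tm M e t \<in> E j"
| "sat M e E (Imp \<phi> \<psi>) \<longleftrightarrow> (sat M e E \<phi> \<longrightarrow> sat M e E \<psi>)"
| "sat M e E (Forall \<phi>) \<longleftrightarrow> (\<forall>a. sat M (case_nat a e) E \<phi>)"
| "sat M e E (ForallS \<phi>) \<longleftrightarrow> (\<forall>A\<in>sets M. sat M e (case_nat A E) \<phi>)"

definition valid_in :: "'a l2_structure \<Rightarrow> fm \<Rightarrow> bool" (infix \<open>\<Turnstile>\<close> 50) where
  "M \<Turnstile> \<phi> \<longleftrightarrow> (\<forall>e E. (\<forall>j. E j \<in> sets M) \<longrightarrow> sat M e E \<phi>)"

definition model_of :: "'a l2_structure \<Rightarrow> fm set \<Rightarrow> bool" where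
  "model_of M \<Gamma> \<longleftrightarrow> sets M \<noteq> {} \<and> (\<forall>\<phi>\<in>\<Gamma>. M \<Turnstile> \<phi>)"

section \<open>The encoded formulas have their intended meaning\<close>

lemma sat_derived_connectives [simp]:
  "sat M e E (Neg \<phi>) \<longleftrightarrow> \<not> sat M e E \<phi>"
  "sat M e E (Conj \<phi> \<psi>) \<longleftrightarrow> sat M e E \<phi> \<and> sat M e E \<psi>"
  "sat M e E (Disj \<phi> \<psi>) \<longleftrightarrow> sat M e E \<phi> \<or> sat M e E \<psi>"
  "sat M e E (Iff \<phi> \<psi>) \<longleftrightarrow> (sat M e E \<phi> \<longleftrightarrow> sat M e E \<psi>)"
  "sat M e E (Exists \<phi>) \<longleftrightarrow> (\<exists>a. sat M (case_nat a e) E \<phi>)"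
  "sat M e E (ExistsS \<phi>) \<longleftrightarrow> (\<exists>A\<in>sets M. sat M e (case_nat A E) \<phi>)"
  by (auto simp: Neg_def Conj_def Disj_def Iff_def Exists_def ExistsS_def)

lemma eval_sub_tm: "eval_tm M e (sub_tm \<sigma> t) = eval_tm M (\<lambda>i. eval_tm M e (\<sigma> i)) t"
  by (induction t) auto

lemma sat_sub: "sat M e E (sub \<sigma> \<rho> \<phi>) \<longleftrightarrow> sat M (\<lambda>i. eval_tm M e (\<sigma> i)) (\<lambda>j. E (\<rho> j)) \<phi>"
proof (induction \<phi> arbitrary: e E \<sigma> \<rho>)
  case (Forall \<phi>)
  have "(\<lambda>i. eval_tm M (case_nat a e) (case_nat (Var 0) (\<lambda>i. lift_tm (\<sigma> i)) i))
      = case_nat a (\<lambda>i. eval_tm M e (\<sigma> i))" for a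
    by (rule ext) (simp add: eval_sub_tm split: nat.split)
  then show ?case by (simp add: Forall)
next
  case (ForallS \<phi>)
  have "(\<lambda>j. case_nat A E (case_nat 0 (\<lambda>j. Suc (\<rho> j)) j)) = case_nat A (\<lambda>j. E (\<rho> j))" for A
    by (rule ext) (simp split: nat.split)
  then show ?case by (simp add: ForallS)
qed (auto simp: eval_sub_tm)

lemma sat_inst: "sat M e E (inst \<phi> t) \<longleftrightarrow> sat M (case_nat (eval_tm M e t) e) E \<phi>"
proof -
  have "(\<lambda>i. eval_tm M e (case_nat t Var i)) = case_nat (eval_tm M e t) e"
    by (rule ext) (simp split: nat.split)
  then show ?thesis by (simp only: sat_sub id_apply)
qed

lemma sat_instS: "sat M e E (instS \<phi> j) \<longleftrightarrow> sat M e (case_nat (E j) E) \<phi>"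
proof -
  have "(\<lambda>i. E (case_nat j id i)) = case_nat (E j) E"
    by (rule ext) (simp split: nat.split)
  then show ?thesis by (simp add: sat_sub)
qed

lemma sat_lift: "sat M (case_nat a e) E (lift \<phi>) \<longleftrightarrow> sat M e E \<phi>"
  and sat_liftS: "sat M e (case_nat A E) (liftS \<phi>) \<longleftrightarrow> sat M e E \<phi>"
  by (simp_all add: sat_sub)

lemma derivable_sound:
  assumes "\<Gamma> \<turnstile> \<phi>" "model_of M \<Gamma>"
  shows "M \<Turnstile> \<phi>"
  using assms(1)
proof induction
  case (assumption \<phi>)
  then show ?case using assms(2) by (simp add: model_of_def)
next
  case (generalizeS \<phi>)
  have "\<forall>j. case_nat A E j \<in> sets M" if "A \<in> sets M" "\<forall>j. E j \<in> sets M" for A and E :: "nat \<Rightarrow> _"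
    using that by (simp split: nat.split)
  with generalizeS show ?case by (simp add: valid_in_def)
qed (simp_all only: valid_in_def sat.simps eval_tm.simps sat_inst sat_instS sat_lift sat_liftS, auto)

lemma sat_induction_ax:
  "sat M e E (induction_ax \<phi>) \<longleftrightarrow>
    (sat M (case_nat (zero M) e) E \<phi> \<longrightarrow>
     (\<forall>a. sat M (case_nat a e) E \<phi> \<longrightarrow> sat M (case_nat (succ M a) e) E \<phi>) \<longrightarrow>
     (\<forall>a. sat M (case_nat a e) E \<phi>))"
proof -
  have "(\<lambda>i. eval_tm M (case_nat a e) (case_nat (Succ (Var 0)) (\<lambda>i. Var (Suc i)) i))
      = case_nat (succ M a) e" for a
    by (rule ext) (simp split: nat.split)
  then show ?thesis
    by (simp only: induction_ax_def sat.simps sat_inst eval_tm.simps) (simp only: sat_sub id_apply)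
qed

lemma sat_delta_comprehension_ax:
  "sat M e E (delta_comprehension_ax \<phi> \<psi>) \<longleftrightarrow>
    ((\<forall>a. sat M (case_nat a e) E \<phi> \<longleftrightarrow> sat M (case_nat a e) E \<psi>) \<longrightarrow>
     (\<exists>A\<in>sets M. \<forall>a. a \<in> A \<longleftrightarrow> sat M (case_nat a e) E \<phi>))"
  unfolding delta_comprehension_ax_def
  by (simp only: sat_derived_connectives sat_liftS sat.simps eval_tm.simps nat.case)

lemma sat_robinson:
  "(\<forall>\<phi>\<in>robinson. sat M e E \<phi>) \<longleftrightarrow>
    (let x = e 0; y = e 1 in
      succ M x \<noteq> zero M \<and>
      (succ M x = succ M y \<longrightarrow> x = y) \<and>
      (x = zero M \<or> (\<exists>z. x = succ M z)) \<and>
      add M x (zero M) = x \<and>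
      add M x (succ M y) = succ M (add M x y) \<and>
      mul M x (zero M) = zero M \<and>
      mul M x (succ M y) = add M (mul M x y) x \<and>
      (lt M x y \<longleftrightarrow> (\<exists>z. add M z (succ M x) = y)))"
  unfolding robinson_def Let_def
  by (simp only: ball_simps simp_thms sat.simps sat_derived_connectives eval_tm.simps nat.case One_nat_def numeral_2_eq_2)

lemma sat_FinCOH:
  defines "pr \<equiv> \<lambda>M x y. add M (mul M (add M x y) (add M x y)) x"
  shows "sat M e E FinCOH \<longleftrightarrow>
    (\<forall>l. \<forall>R\<in>sets M. \<exists>H\<in>sets M. (\<forall>b. \<exists>x. lt M b x \<and> x \<in> H) \<and>
      (\<forall>k. lt M k l \<longrightarrow>
        (\<exists>b. \<forall>x. lt M b x \<longrightarrow> x \<in> H \<longrightarrow> pr M k x \<in> R) \<or>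
        (\<exists>b. \<forall>x. lt M b x \<longrightarrow> x \<in> H \<longrightarrow> pr M k x \<notin> R)))"
  unfolding FinCOH_def infinite_fm_def pair_tm_def pr_def
  by (simp only: sat.simps sat_derived_connectives eval_tm.simps nat.case One_nat_def numeral_2_eq_2)

lemma sat_WKL:
  defines "pr \<equiv> \<lambda>M x y. add M (mul M (add M x y) (add M x y)) x"
  defines "s0 \<equiv> \<lambda>M s. succ M (add M s s)"
  defines "s1 \<equiv> \<lambda>M s. succ M (succ M (add M s s))"
  shows "sat M e E WKL \<longleftrightarrow>
    (\<forall>T\<in>sets M. (\<forall>s. s0 M s \<in> T \<or> s1 M s \<in> T \<longrightarrow> s \<in> T) \<and> (\<forall>b. \<exists>x. lt M b x \<and> x \<in> T) \<longrightarrow>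
      (\<exists>X\<in>sets M. \<exists>P\<in>sets M.
        (\<forall>s. pr M (zero M) s \<in> P \<longleftrightarrow> s = zero M) \<and>
        (\<forall>n s. pr M (succ M n) s \<in> P \<longleftrightarrow>
          (\<exists>r. pr M n r \<in> P \<and> (n \<notin> X \<and> s = s0 M r \<or> n \<in> X \<and> s = s1 M r))) \<and>
        (\<forall>n s. pr M n s \<in> P \<longrightarrow> s \<in> T)))"
  unfolding WKL_def tree_fm_def infinite_fm_def path_fm_def initial_segments_fm_def
    pair_tm_def pr_def s0_def s1_def
  by (simp only: conj_assoc sat.simps sat_derived_connectives eval_tm.simps nat.case One_nat_def numeral_2_eq_2)

end

theory Submission
  imports Defs "HOL-Library.Countable_Set" "HOL-Library.Nat_Bijection"
begin

text \<open>
  The model is a semiregular cut \<open>I\<close> in a countable nonstandard model \<open>K\<close> of true arithmetic, with the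
  traces on \<open>I\<close> of the \<open>K\<close>-finite sets as second-order part. Semiregularity, which says that every
  \<open>K\<close>-finite set with at most \<open>a \<in> I\<close> elements meets \<open>I\<close> in a bounded set, gives \<open>WKL0\<close>.

  To make \<open>FinCOH\<close> fail, partition \<open>\<nat>\<close> into blocks of level \<open>0, 1, 2, \<dots>\<close>, each block of level
  \<open>k + 1\<close> being a long run of blocks of level \<open>k\<close>, and let \<open>R k\<close> be the union of every second block
  of level \<open>k\<close>. The cut is determined by a decreasing sequence of blocks whose levels stay infinitely
  far above a level \<open>q\<close> such that \<open>I\<close> remains a limit of blocks of level \<open>q\<close>. At each step a given
  \<open>K\<close>-finite set \<open>H\<close> either misses a block of some level \<open>r\<close> halfway between the two levels, which
  becomes the next block and bounds \<open>H \<inter> I\<close>, or it meets all blocks of level \<open>r\<close>; then \<open>q\<close> is raised to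
  \<open>r + 1\<close>, so that \<open>H\<close> meets both \<open>R r\<close> and its complement cofinally in \<open>I\<close>. So no \<open>H\<close> is cohesive
  for the sequence of all \<open>R k\<close> with \<open>k < \<ell>\<close>, for \<open>\<ell>\<close> nonstandard.
\<close>

instance tm :: countable by countable_datatype
instance fm :: countable by countable_datatype

section \<open>Ultrafilters and Skolem closures\<close>

text \<open>\<open>U\<close> is a minimal proper filter below \<open>sequentially\<close>, found by
  Zorn's lemma: the infimum of a nonempty chain of proper filters is proper. Lying below
  \<open>sequentially\<close> makes it nonprincipal.\<close>

lemma exists_ultrafilter:
  obtains U :: "nat filter"
  where "U \<noteq> bot" "U \<le> sequentially" "\<And>P. \<not> eventually P U \<longleftrightarrow> eventually (\<lambda>n. \<not> P n) U"
proof -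
  let ?A = "{V :: nat filter. V \<noteq> bot \<and> V \<le> sequentially}"
  have "\<exists>V\<in>?A. \<forall>W\<in>?A. V \<ge> W \<longrightarrow> W = V"
  proof (rule predicate_Zorn)
    show "partial_order_on ?A (relation_of (\<ge>) ?A)"
      by (rule partial_order_on_relation_ofI) auto
  next
    fix C assume "C \<in> Chains (relation_of (\<ge>) ?A)"
    then have C: "C \<subseteq> ?A" and tot: "\<And>V W. V \<in> C \<Longrightarrow> W \<in> C \<Longrightarrow> V \<le> W \<or> W \<le> V"
      by (auto simp: Chains_def relation_of_def)
    show "\<exists>V\<in>?A. \<forall>W\<in>C. W \<ge> V"
    proof (cases "C = {}")
      case True
      then show ?thesis by (intro bexI[of _ sequentially]) auto
    next
      case False
      have "\<exists>x\<in>C. x \<le> inf V W" if "V \<in> C" "W \<in> C" for V W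
        using tot[OF that] that by (auto simp: inf_absorb1 inf_absorb2)
      then have "eventually P (Inf C) \<longleftrightarrow> (\<exists>V\<in>C. eventually P V)" for P
        by (rule eventually_Inf_base[OF False])
      moreover have "\<not> eventually (\<lambda>_. False) V" if "V \<in> C" for V
        using C that by (auto simp: trivial_limit_def)
      ultimately have "Inf C \<noteq> bot" by (simp add: trivial_limit_def)
      moreover have "Inf C \<le> sequentially"
        using False C by (metis (mono_tags, lifting) Inf_lower2 all_not_in_conv mem_Collect_eq subsetD)
      ultimately show ?thesis by (auto intro!: bexI[of _ "Inf C"] Inf_lower)
    qed
  qed
  then obtain U where U: "U \<noteq> bot" "U \<le> sequentially"
    and min: "\<And>W. W \<noteq> bot \<Longrightarrow> W \<le> U \<Longrightarrow> W = U"
    by (auto intro: order.trans)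
  \<comment> \<open>Restricting \<open>U\<close> to \<open>P\<close> leaves it proper here, so by
    minimality the restriction is \<open>U\<close> itself.\<close>
  have "eventually P U" if "\<not> eventually (\<lambda>n. \<not> P n) U" for P
  proof -
    have "inf U (principal {n. P n}) \<noteq> bot"
      using that by (simp add: trivial_limit_def eventually_inf_principal)
    then have "inf U (principal {n. P n}) = U" by (rule min) simp
    moreover have "eventually P (inf U (principal {n. P n}))"
      by (simp add: eventually_inf_principal)
    ultimately show ?thesis by simp
  qed
  moreover have "\<not> eventually P U" if "eventually (\<lambda>n. \<not> P n) U" for P
    using eventually_conj[OF that, of P] U(1) by (auto simp: trivial_limit_def)
  ultimately show thesis using that U by blast
qed

datatype skolem_term = Index | App nat "skolem_term list"

instance skolem_term :: countable by countable_datatype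

primrec skolem_eval :: "(nat \<Rightarrow> nat list \<Rightarrow> nat) \<Rightarrow> nat \<Rightarrow> skolem_term \<Rightarrow> nat" where
  "skolem_eval f n Index = n"
| "skolem_eval f n (App k ts) = f k (map (skolem_eval f n) ts)"

text \<open>\<open>F\<close> collects the values of terms built from the index \<open>n\<close> and
  one choice function per predicate, and there are only countably many terms. Choosing from the list
  of values at \<open>n\<close> lets one \<open>g\<close> serve all \<open>n\<close> at
  once.\<close>

lemma exists_skolem_closure:
  fixes PP :: "(nat list \<Rightarrow> nat \<Rightarrow> bool) set"
  assumes "countable PP"
  obtains F :: "(nat \<Rightarrow> nat) set"
  where "countable F" "id \<in> F"
    "\<And>P gs. P \<in> PP \<Longrightarrow> set gs \<subseteq> F \<Longrightarrow>
      \<exists>g\<in>F. \<forall>n. (\<exists>y. P (map (\<lambda>h. h n) gs) y) \<longrightarrow> P (map (\<lambda>h. h n) gs) (g n)"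
proof -
  define f where "f k xs = (SOME y. from_nat_into PP k xs y)" for k xs
  let ?F = "range (\<lambda>t n. skolem_eval f n t)"
  show thesis
  proof
    show "countable ?F" by simp
    have "id = (\<lambda>n. skolem_eval f n Index)" by auto
    then show "id \<in> ?F" by blast
    fix P gs assume P: "P \<in> PP" and gs: "set gs \<subseteq> ?F"
    obtain k where k: "from_nat_into PP k = P"
      using from_nat_into_surj[OF assms P] by blast
    from gs obtain ts where ts: "gs = map (\<lambda>t n. skolem_eval f n t) ts"
      by (metis ex_map_conv rangeE subsetD)
    have "P (map (\<lambda>h. h n) gs) (skolem_eval f n (App k ts))"
      if "P (map (\<lambda>h. h n) gs) y" for n y
    proof -
      have "map (\<lambda>h. h n) gs = map (skolem_eval f n) ts" by (simp add: ts o_def)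
      with that show ?thesis by (auto simp: f_def k intro: someI)
    qed
    then show "\<exists>g\<in>?F. \<forall>n. (\<exists>y. P (map (\<lambda>h. h n) gs) y) \<longrightarrow> P (map (\<lambda>h. h n) gs) (g n)"
      by (intro bexI[of _ "\<lambda>n. skolem_eval f n (App k ts)"] rangeI) auto
  qed
qed

section \<open>Blocks\<close>

text \<open>
  The \<open>2 ^ u\<close> at the bottom level makes every cut that is a limit of blocks closed under
  exponentiation. A block of level \<open>k + 1\<close> starting at \<open>u\<close> consists of \<open>u + 2\<close> blocks of level
  \<open>k\<close>, so that a set of at most \<open>u\<close> points misses one of them other than the first.
\<close>

primrec block_end :: "nat \<Rightarrow> nat \<Rightarrow> nat" where
  "block_end 0 = (\<lambda>u. u + 2 ^ u)"
| "block_end (Suc k) = (\<lambda>u. (block_end k ^^ (u + 2)) u)"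

definition block_starts :: "nat \<Rightarrow> nat set" where
  "block_starts k = range (\<lambda>j. (block_end k ^^ j) 0)"

text \<open>The union of the even-numbered blocks of level \<open>k\<close>: the \<open>k\<close>-th set of the bad instance.\<close>

definition colour :: "nat \<Rightarrow> nat set" where
  "colour k = {x. \<exists>j. even j \<and> (block_end k ^^ j) 0 \<le> x \<and> x < (block_end k ^^ Suc j) 0}"

lemma funpow_strict_mono_nat:
  fixes f :: "nat \<Rightarrow> nat"
  assumes "\<And>u. u < f u" "i < j"
  shows "(f ^^ i) u < (f ^^ j) u"
  using assms(2) by (rule lift_Suc_mono_less[rotated]) (simp add: assms(1))

lemma less_block_end: "u < block_end k u"
proof (induction k arbitrary: u)
  case (Suc k)
  show ?case using funpow_strict_mono_nat[of "block_end k" 0 "u + 2" u] Suc by simp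
qed simp

lemma block_end_funpow_less: "i < j \<Longrightarrow> (block_end k ^^ i) u < (block_end k ^^ j) u"
  by (rule funpow_strict_mono_nat[OF less_block_end])

lemma block_end_funpow_le: "i \<le> j \<Longrightarrow> (block_end k ^^ i) u \<le> (block_end k ^^ j) u"
  using block_end_funpow_less[where i = i and j = j and k = k and u = u] by (cases "i = j") auto

lemma block_end_funpow_le_Suc: "i \<le> u + 2 \<Longrightarrow> (block_end k ^^ i) u \<le> block_end (Suc k) u"
  using block_end_funpow_le[of i "u + 2" k u] by simp

lemma block_end_le_mono: "k \<le> k' \<Longrightarrow> block_end k u \<le> block_end k' u"
proof (induction rule: dec_induct)
  case (step k')
  then show ?case using block_end_funpow_le_Suc[of 1 u k'] by simp
qed simp

lemma block_starts_0: "0 \<in> block_starts k"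
  unfolding block_starts_def by (rule range_eqI[of _ _ 0]) simp

lemma block_starts_funpow: "u \<in> block_starts k \<Longrightarrow> (block_end k ^^ j) u \<in> block_starts k"
  unfolding block_starts_def by (auto intro: rangeI simp: funpow_add[unfolded fun_eq_iff o_apply, rule_format, symmetric])

lemma block_starts_blk: "u \<in> block_starts k \<Longrightarrow> block_end k u \<in> block_starts k"
  using block_starts_funpow[of u k 1] by simp

text \<open>A step of level \<open>k + 1\<close> from \<open>w\<close> is an iterate of steps of
  level \<open>k\<close>, so it leads from one boundary of level \<open>k\<close> to
  another.\<close>

lemma block_starts_Suc_subset: "block_starts (Suc k) \<subseteq> block_starts k"
proof -
  have "(block_end (Suc k) ^^ j) 0 \<in> block_starts k" for j
  proof (induction j)
    case (Suc j)
    define w where "w = (block_end (Suc k) ^^ j) 0"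
    have "(block_end (Suc k) ^^ Suc j) 0 = (block_end k ^^ (w + 2)) w" by (simp add: w_def)
    then show ?case using block_starts_funpow[of w k "w + 2"] Suc by (simp only: w_def)
  qed (simp add: block_starts_0)
  then show ?thesis by (auto simp: block_starts_def[of "Suc k"])
qed

lemma block_starts_antimono: "k \<le> k' \<Longrightarrow> block_starts k' \<subseteq> block_starts k"
  by (rule lift_Suc_antimono_le[of block_starts]) (use block_starts_Suc_subset in auto)

lemma block_starts_unbounded: "\<exists>u\<in>block_starts k. a \<le> u"
proof -
  have "a \<le> (block_end k ^^ a) 0" 
  proof (induction a)
    case (Suc a)
    then show ?case using less_block_end[of "(block_end k ^^ a) 0" k] by simp
  qed simp
  then show ?thesis by (auto simp: block_starts_def)
qed

text \<open>Boundaries increase strictly, so a point lies in only one block, and the parity of that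
  block's number decides membership in \<open>colour k\<close>. Consecutive blocks have opposite
  parity.\<close>

lemma colour_alternates:
  assumes "v \<in> block_starts k"
  shows "{v..<block_end k v} \<subseteq> colour k \<and> {block_end k v..<block_end k (block_end k v)} \<inter> colour k = {} \<or>
    {v..<block_end k v} \<inter> colour k = {} \<and> {block_end k v..<block_end k (block_end k v)} \<subseteq> colour k"
proof -
  let ?b = "\<lambda>j. (block_end k ^^ j) 0"
  from assms obtain i where v: "v = ?b i" by (auto simp: block_starts_def)
  have uniq: "j = j'" if "?b j \<le> x" "x < ?b (Suc j)" "?b j' \<le> x" "x < ?b (Suc j')" for j j' x
  proof (rule ccontr)
    assume "j \<noteq> j'"
    then have "Suc j \<le> j' \<or> Suc j' \<le> j" by auto
    with block_end_funpow_le[of "Suc j" j' k 0] block_end_funpow_le[of "Suc j'" j k 0] that show False by linarith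
  qed
  have in_colour: "x \<in> colour k \<longleftrightarrow> even j" if "?b j \<le> x" "x < ?b (Suc j)" for j x
    using uniq that unfolding colour_def by blast
  have "block_end k v = ?b (Suc i)" "block_end k (block_end k v) = ?b (Suc (Suc i))" by (simp_all add: v)
  then show ?thesis
    using in_colour[of i] in_colour[of "Suc i"] v by (cases "even i") (auto simp del: funpow.simps)
qed

text \<open>Pigeonhole: all of the \<open>u + 2\<close> subblocks except the first are candidates,
  and \<open>u\<close> points cannot meet \<open>u + 1\<close> disjoint intervals. Leaving out the
  first one moves the start past \<open>block_end (p - 1) u\<close>.\<close>

lemma free_subblock:
  assumes "0 < p" "u \<in> block_starts p" "finite Y"
  shows "\<exists>v. v \<in> block_starts (p - 1) \<and> block_end (p - 1) u \<le> v \<and> block_end (p - 1) v \<le> block_end p u \<and>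
    (card Y \<le> u \<longrightarrow> Y \<inter> {v..<block_end (p - 1) v} = {})"
proof -
  obtain k where p: "p = Suc k" using assms(1) by (cases p) auto
  define w where "w j = (block_end k ^^ Suc j) u" for j
  have w_step: "w (Suc j) = block_end k (w j)" for j by (simp add: w_def)
  have u: "u \<in> block_starts k" using assms(2) block_starts_Suc_subset p by auto
  have w: "w j \<in> block_starts k" "block_end k u \<le> w j" for j
    using block_starts_funpow[OF u, of "Suc j"] block_end_funpow_le[of 1 "Suc j" k u] by (simp_all only: w_def) simp
  have w_top: "block_end k (w j) \<le> block_end p u" if "j \<le> u" for j
    using block_end_funpow_le_Suc[of "Suc (Suc j)" u k] that by (simp add: p w_def)
  show ?thesis
  proof (cases "\<exists>j\<le>u. Y \<inter> {w j..<w (Suc j)} = {}")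
    case True
    then show ?thesis using w w_top by (auto simp: w_step p)
  next
    case False
    then have "\<forall>j\<in>{..u}. \<exists>z. z \<in> Y \<inter> {w j..<w (Suc j)}" by blast
    from bchoice[OF this] obtain y
      where y: "\<And>j. j \<le> u \<Longrightarrow> y j \<in> Y \<inter> {w j..<w (Suc j)}" by auto
    have less: "y i < y j" if "i < j" "j \<le> u" for i j
      using y[of i] y[of j] that block_end_funpow_le[of "Suc (Suc i)" "Suc j" k u] by (simp add: w_def del: funpow.simps)
    have "inj_on y {..u}"
    proof (rule inj_onI, rule ccontr)
      fix i j assume "i \<in> {..u}" "j \<in> {..u}" "y i = y j" "i \<noteq> j"
      then show False using less[of i j] less[of j i] by (cases "i < j") auto
    qed
    then have "Suc u \<le> card Y"
      using card_inj_on_le[of y "{..u}" Y] y assms(3) by auto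
    then have "\<not> card Y \<le> u" by simp
    \<comment> \<open>A set with more than \<open>u\<close> points does not have to be missed, so
      the first candidate will do.\<close>
    then show ?thesis using w[of 0] w_top[of 0] by (intro exI[of _ "w 0"]) (simp add: p)
  qed
qed

text \<open>As \<open>w + 2 \<ge> 2\<close>, the block contains at least two blocks of level
  \<open>r\<close>; the first two have opposite colours, and \<open>H\<close> meets both.\<close>

lemma block_meets_both_colours:
  assumes w: "w \<in> block_starts (Suc r)"
    and hit: "\<And>w'. w' \<in> block_starts r \<Longrightarrow> w \<le> w' \<Longrightarrow> block_end r w' \<le> block_end (Suc r) w \<Longrightarrow> H \<inter> {w'..<block_end r w'} \<noteq> {}"
  shows "\<exists>h. h \<in> H \<inter> {w..<block_end (Suc r) w} \<inter> colour r" "\<exists>h. h \<in> H \<inter> {w..<block_end (Suc r) w} - colour r"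
proof -
  let ?w = "block_end r w"
  have block_starts: "w \<in> block_starts r" "?w \<in> block_starts r" using w block_starts_Suc_subset block_starts_blk by blast+
  have le: "?w \<le> block_end r ?w" "block_end r ?w \<le> block_end (Suc r) w" "w \<le> ?w"
    using less_block_end[of ?w r] less_block_end[of w r] block_end_funpow_le_Suc[of 2 w r] by (simp_all add: numeral_2_eq_2)
  have hits: "H \<inter> {w..<?w} \<noteq> {}" "H \<inter> {?w..<block_end r ?w} \<noteq> {}"
    using hit[OF block_starts(1)] hit[OF block_starts(2)] le by auto
  have sub: "{w..<?w} \<subseteq> {w..<block_end (Suc r) w}" "{?w..<block_end r ?w} \<subseteq> {w..<block_end (Suc r) w}"
    using le by auto
  from colour_alternates[OF block_starts(1)] hits sub
  show "\<exists>h. h \<in> H \<inter> {w..<block_end (Suc r) w} \<inter> colour r" "\<exists>h. h \<in> H \<inter> {w..<block_end (Suc r) w} - colour r"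
    by blast+
qed

section \<open>Normal forms of formulas\<close>

lemma sub_tm_lift_tm: "sub_tm (case_nat (Var 0) (\<lambda>i. lift_tm (\<sigma> i))) (lift_tm t) = lift_tm (sub_tm \<sigma> t)"
  by (induction t) auto

lemma Delta00_sub: "Delta00 \<phi> \<Longrightarrow> Delta00 (sub \<sigma> \<rho> \<phi>)"
proof (induction arbitrary: \<sigma> \<rho> rule: Delta00.induct)
  case (7 \<phi> t)
  have "sub \<sigma> \<rho> (Exists (Conj (Less (Var 0) (lift_tm t)) \<phi>)) =
    Exists (Conj (Less (Var 0) (lift_tm (sub_tm \<sigma> t))) (sub (case_nat (Var 0) (\<lambda>i. lift_tm (\<sigma> i))) \<rho> \<phi>))"
    by (simp add: Exists_def Conj_def Neg_def sub_tm_lift_tm)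
  then show ?case using 7 by (simp only: Delta00.intros)
qed (simp_all only: sub.simps sub_tm.simps sub_tm_lift_tm nat.case Delta00.intros)

lemma Delta00_Neg: "Delta00 \<phi> \<Longrightarrow> Delta00 (Neg \<phi>)"
  unfolding Neg_def by (intro Delta00.intros)

text \<open>Two witnesses have a common strict upper bound \<open>c\<close>, so two unbounded
  quantifiers become a single one over \<open>c\<close> followed by two bounded ones.\<close>

lemma collapse_exists:
  fixes M :: "'a l2_structure"
  assumes directed: "\<And>x y. \<exists>c. lt M x c \<and> lt M y c" and \<theta>: "Delta00 \<theta>"
  shows "\<exists>\<theta>'. Delta00 \<theta>' \<and>
    (\<forall>e E. (\<exists>y b. sat M (case_nat b (case_nat y e)) E \<theta>) \<longleftrightarrow> (\<exists>c. sat M (case_nat c e) E \<theta>'))"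
proof -
  \<comment> \<open>Below the two bounded quantifiers, index 2 is the new bound \<open>c\<close>;
    the parameters of \<open>\<theta>\<close> are moved past it.\<close>
  define \<sigma> where "\<sigma> = case_nat (Var 0) (case_nat (Var 1) (\<lambda>i. Var (i + 3)))"
  define \<theta>' where "\<theta>' =
    Exists (Conj (Less (Var 0) (lift_tm (Var 0)))
      (Exists (Conj (Less (Var 0) (lift_tm (Var 1))) (sub \<sigma> id \<theta>))))"
  have "Delta00 \<theta>'"
    unfolding \<theta>'_def by (intro Delta00.intros Delta00_sub \<theta>)
  moreover have env: "(\<lambda>i. eval_tm M (case_nat b (case_nat y (case_nat c e))) (\<sigma> i)) = case_nat b (case_nat y e)"
    for b y c e
    by (rule ext) (simp add: \<sigma>_def split: nat.split)
  have "sat M (case_nat c e) E \<theta>' \<longleftrightarrow>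
    (\<exists>y. lt M y c \<and> (\<exists>b. lt M b c \<and> sat M (case_nat b (case_nat y e)) E \<theta>))" for c e E
    unfolding \<theta>'_def by (simp add: sat_sub env)
  then have "(\<exists>y b. sat M (case_nat b (case_nat y e)) E \<theta>) \<longleftrightarrow> (\<exists>c. sat M (case_nat c e) E \<theta>')" for e E
    using directed by metis
  ultimately show ?thesis by blast
qed

text \<open>\<open>Pi0\<close> formulas are treated through their negations, so both classes get an
  existential form. The mutual induction runs through all levels, hence the implications from
  \<open>n = 0\<close> and \<open>n = 1\<close>.\<close>

lemma Sigma1_Pi1_normal_form:
  fixes M :: "'a l2_structure"
  assumes directed: "\<And>x y. \<exists>c. lt M x c \<and> lt M y c"
  shows "Sigma0 n \<phi> \<Longrightarrow> (n = 0 \<longrightarrow> Delta00 \<phi>) \<and>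
      (n = 1 \<longrightarrow> (\<exists>\<theta>. Delta00 \<theta> \<and> (\<forall>e E. sat M e E \<phi> \<longleftrightarrow> (\<exists>b. sat M (case_nat b e) E \<theta>))))"
    and "Pi0 n \<phi> \<Longrightarrow> (n = 0 \<longrightarrow> Delta00 \<phi>) \<and>
      (n = 1 \<longrightarrow> (\<exists>\<theta>. Delta00 \<theta> \<and> (\<forall>e E. \<not> sat M e E \<phi> \<longleftrightarrow> (\<exists>b. sat M (case_nat b e) E \<theta>))))"
proof (induction rule: Sigma0_Pi0.inducts)
  \<comment> \<open>A \<open>Delta00\<close> formula receives a dummy quantifier by lifting.\<close>
  case (3 n \<phi>)
  then show ?case by (auto intro!: exI[of _ "lift \<phi>"] Delta00_sub simp: sat_lift simp del: sat_sub)
next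
  case (4 n \<phi>)
  have "\<exists>\<theta>'. Delta00 \<theta>' \<and> (\<forall>e E. sat M e E (Exists \<phi>) \<longleftrightarrow> (\<exists>c. sat M (case_nat c e) E \<theta>'))" if "n = 0"
  proof -
    from 4 that obtain \<theta> where "Delta00 \<theta>"
      and \<theta>: "\<And>e E. sat M e E \<phi> \<longleftrightarrow> (\<exists>b. sat M (case_nat b e) E \<theta>)" by auto
    from collapse_exists[OF directed this(1)] show ?thesis by (simp add: \<theta>)
  qed
  then show ?case by simp
next
  case (5 n \<phi>)
  then show ?case by (auto intro!: exI[of _ "Neg (lift \<phi>)"] Delta00_sub Delta00_Neg simp: sat_lift)
next
  case (6 n \<phi>)
  have "\<exists>\<theta>'. Delta00 \<theta>' \<and> (\<forall>e E. \<not> sat M e E (Forall \<phi>) \<longleftrightarrow> (\<exists>c. sat M (case_nat c e) E \<theta>'))" if "n = 0"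
  proof -
    from 6 that obtain \<theta> where "Delta00 \<theta>"
      and \<theta>: "\<And>e E. \<not> sat M e E \<phi> \<longleftrightarrow> (\<exists>b. sat M (case_nat b e) E \<theta>)" by auto
    from collapse_exists[OF directed this(1)] show ?thesis by (simp add: \<theta>)
  qed
  then show ?case by simp
qed auto

section \<open>Formulas depend on finitely many parameters\<close>

primrec tm_bound :: "tm \<Rightarrow> nat" where
  "tm_bound (Var i) = Suc i"
| "tm_bound Zero = 0"
| "tm_bound (Succ t) = tm_bound t"
| "tm_bound (Add t u) = max (tm_bound t) (tm_bound u)"
| "tm_bound (Mul t u) = max (tm_bound t) (tm_bound u)"

text \<open>One coarse bound serves number and set indices alike, and it does not drop under
  quantifiers: its purpose is to cut the parameters down to a finite list that a predicate in
  \<open>preds\<close> can take.\<close>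

primrec fm_bound :: "fm \<Rightarrow> nat" where
  "fm_bound Bot = 0"
| "fm_bound (Eq t u) = max (tm_bound t) (tm_bound u)"
| "fm_bound (Less t u) = max (tm_bound t) (tm_bound u)"
| "fm_bound (Mem t j) = max (tm_bound t) (Suc j)"
| "fm_bound (Imp \<phi> \<psi>) = max (fm_bound \<phi>) (fm_bound \<psi>)"
| "fm_bound (Forall \<phi>) = fm_bound \<phi>"
| "fm_bound (ForallS \<phi>) = fm_bound \<phi>"

lemma eval_tm_cong:
  "\<forall>i<tm_bound t. e i = e' i \<Longrightarrow> eval_tm M e t = eval_tm M e' t"
  by (induction t) auto

lemma sat_cong:
  "\<forall>i<fm_bound \<phi>. e i = e' i \<and> E i = E' i \<Longrightarrow> sat M e E \<phi> \<longleftrightarrow> sat M e' E' \<phi>"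
proof (induction \<phi> arbitrary: e e' E E')
  case (Eq t u)
  then show ?case using eval_tm_cong[of t e e' M] eval_tm_cong[of u e e' M] by simp
next
  case (Less t u)
  then show ?case using eval_tm_cong[of t e e' M] eval_tm_cong[of u e e' M] by simp
next
  case (Mem t j)
  then show ?case using eval_tm_cong[of t e e' M] by simp
next
  case (Imp \<phi> \<psi>)
  have "sat M e E \<phi> \<longleftrightarrow> sat M e' E' \<phi>" by (rule Imp.IH(1)) (use Imp.prems in auto)
  moreover have "sat M e E \<psi> \<longleftrightarrow> sat M e' E' \<psi>" by (rule Imp.IH(2)) (use Imp.prems in auto)
  ultimately show ?case by simp
next
  case (Forall \<phi>)
  have "sat M (case_nat a e) E \<phi> \<longleftrightarrow> sat M (case_nat a e') E' \<phi>" for a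
    by (rule Forall.IH) (use Forall.prems in \<open>auto split: nat.split\<close>)
  then show ?case by simp
next
  case (ForallS \<phi>)
  have "sat M e (case_nat A E) \<phi> \<longleftrightarrow> sat M e' (case_nat A E') \<phi>" for A
    by (rule ForallS.IH) (use ForallS.prems in \<open>auto split: nat.split\<close>)
  then show ?case by simp
qed simp

section \<open>The standard structure and auxiliary formulas evaluated in it\<close>

definition std :: "nat l2_structure" where
  "std = \<lparr>zero = 0, succ = Suc, add = (+), mul = (*), lt = (<), sets = UNIV\<rparr>"

lemma std_simps [simp]:
  "zero std = 0" "succ std = Suc" "add std = (+)" "mul std = (*)" "lt std = (<)"
  by (simp_all add: std_def)

text \<open>Here \<open>b\<close> is variable 0 and \<open>a\<close> is variable 1. Admitting only
  the least witness of each \<open>x \<le> a\<close> leaves at most \<open>a + 1\<close> values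
  \<open>b\<close>.\<close>

definition least_values_fm :: "fm \<Rightarrow> fm" where
  "least_values_fm \<theta> =
    Exists (Conj (Less (Var 0) (Succ (Var 2)))
      (Conj (sub (case_nat (Var 1) (case_nat (Var 0) (\<lambda>i. Var (i + 3)))) id \<theta>)
        (Forall (Imp (Less (Var 0) (Var 2))
          (Neg (sub (case_nat (Var 0) (case_nat (Var 1) (\<lambda>i. Var (i + 4)))) id \<theta>))))))"

lemma sat_least_values_fm:
  "sat std (case_nat b (case_nat a e)) E (least_values_fm \<theta>) \<longleftrightarrow>
    (\<exists>x<Suc a. sat std (case_nat b (case_nat x e)) E \<theta> \<and>
      (\<forall>z<b. \<not> sat std (case_nat z (case_nat x e)) E \<theta>))"
proof -
  have 1: "(\<lambda>i. eval_tm std (case_nat x (case_nat b (case_nat a e)))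
      (case_nat (Var 1) (case_nat (Var 0) (\<lambda>i. Var (i + 3))) i)) = case_nat b (case_nat x e)" for x
    by (rule ext) (simp split: nat.split)
  have 2: "(\<lambda>i. eval_tm std (case_nat z (case_nat x (case_nat b (case_nat a e))))
      (case_nat (Var 0) (case_nat (Var 1) (\<lambda>i. Var (i + 4))) i)) = case_nat z (case_nat x e)" for x z
    by (rule ext) (simp split: nat.split add: numeral_eq_Suc)
  show ?thesis
    unfolding least_values_fm_def sat_derived_connectives sat.simps sat_sub 1 2
    by (simp add: numeral_2_eq_2)
qed

text \<open>Variables 0, 1, 2 are \<open>x\<close>, \<open>a\<close>, \<open>m\<close>: some
  \<open>x \<le> a\<close> has no witness below \<open>m\<close>. In the proof of induction the
  least such \<open>x\<close> is the counterexample.\<close>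

definition unbounded_fm :: "fm \<Rightarrow> fm" where
  "unbounded_fm \<theta> = Conj (Less (Var 0) (Succ (Var 1)))
    (Neg (Exists (Conj (Less (Var 0) (Var 3))
      (sub (case_nat (Var 0) (case_nat (Var 1) (\<lambda>i. Var (i + 4)))) id \<theta>))))"

lemma sat_unbounded_fm:
  "sat std (case_nat x (case_nat a (case_nat m e))) E (unbounded_fm \<theta>) \<longleftrightarrow>
    x < Suc a \<and> \<not> (\<exists>y<m. sat std (case_nat y (case_nat x e)) E \<theta>)"
proof -
  have 2: "(\<lambda>i. eval_tm std (case_nat z (case_nat x (case_nat a (case_nat m e))))
      (case_nat (Var 0) (case_nat (Var 1) (\<lambda>i. Var (i + 4))) i)) = case_nat z (case_nat x e)" for z
    by (rule ext) (simp split: nat.split add: numeral_eq_Suc)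
  show ?thesis
    unfolding unbounded_fm_def sat_derived_connectives sat.simps sat_sub 2
    by (simp add: numeral_3_eq_3)
qed

text \<open>
  \<open>\<theta>\<close> has a witness with no earlier witness for \<open>\<eta>\<close>: if \<open>\<exists>y. \<theta>\<close> and \<open>\<exists>y. \<eta>\<close> are complementary on the
  cut, this defines an internal set that agrees with \<open>\<exists>y. \<theta>\<close> there.
\<close>

definition race_fm :: "fm \<Rightarrow> fm \<Rightarrow> fm" where
  "race_fm \<theta> \<eta> = Exists (Conj \<theta>
    (Forall (Imp (Less (Var 0) (Var 1)) (Neg (sub (case_nat (Var 0) (\<lambda>i. Var (i + 2))) id \<eta>)))))"

lemma sat_race_fm:
  "sat std e E (race_fm \<theta> \<eta>) \<longleftrightarrow>
    (\<exists>y. sat std (case_nat y e) E \<theta> \<and> (\<forall>z<y. \<not> sat std (case_nat z e) E \<eta>))"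
proof -
  have 1: "(\<lambda>i. eval_tm std (case_nat z (case_nat y e)) (case_nat (Var 0) (\<lambda>i. Var (i + 2)) i)) = case_nat z e" for y z
    by (rule ext) (simp split: nat.split)
  show ?thesis
    unfolding race_fm_def sat_derived_connectives sat.simps sat_sub 1 by simp
qed

text \<open>Every element is the value at some \<open>x < k\<close> of the map sending
  \<open>x\<close> to its least witness.\<close>

lemma card_least_values: "card {b::nat. b < d \<and> (\<exists>x::nat<k. T b x \<and> (\<forall>z<b. \<not> T z x))} \<le> k"
proof -
  have "{b. b < d \<and> (\<exists>x<k. T b x \<and> (\<forall>z<b. \<not> T z x))} \<subseteq> (\<lambda>x. LEAST b. T b x) ` {..<k}"
  proof clarify
    fix b x assume "x < k" "T b x" "\<forall>z<b. \<not> T z x"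
    then have "b = (LEAST b. T b x)" by (intro Least_equality[symmetric]) (auto simp: not_less[symmetric])
    then show "b \<in> (\<lambda>x. LEAST b. T b x) ` {..<k}" using \<open>x < k\<close> by blast
  qed
  then have "card {b. b < d \<and> (\<exists>x<k. T b x \<and> (\<forall>z<b. \<not> T z x))} \<le> card ((\<lambda>x. LEAST b. T b x) ` {..<k})"
    by (intro card_mono) auto
  also have "\<dots> \<le> k" using card_image_le[of "{..<k}"] by simp
  finally show ?thesis .
qed

section \<open>Binary strings\<close>

abbreviation pairing :: "nat \<Rightarrow> nat \<Rightarrow> nat" where
  "pairing x y \<equiv> (x + y) * (x + y) + x"

text \<open>The value lies between the squares of \<open>x + y\<close> and \<open>x + y + 1\<close>,
  so it determines \<open>x + y\<close> and then \<open>x\<close>.\<close>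

lemma pairing_inj: "pairing x y = pairing x' y' \<longleftrightarrow> x = x' \<and> y = y'"
proof -
  have less: "pairing x y < pairing x' y'" if "x + y < x' + y'" for x y x' y' :: nat
  proof -
    have "pairing x y < Suc (x + y) * Suc (x + y)" by simp
    also have "\<dots> \<le> (x' + y') * (x' + y')" using that by (intro mult_le_mono) auto
    finally show ?thesis by simp
  qed
  show ?thesis using less[of x y x' y'] less[of x' y' x y]
    by (cases "x + y" "x' + y'" rule: linorder_cases) auto
qed

text \<open>Deletes the last bit of a string code. Truncated subtraction makes the empty string its
  own parent.\<close>

definition parent :: "nat \<Rightarrow> nat" where "parent s = (s - 1) div 2"

fun string_length :: "nat \<Rightarrow> nat" where
  "string_length 0 = 0"
| "string_length (Suc s) = Suc (string_length (s div 2))"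

text \<open>The initial segment of length \<open>i\<close>; for \<open>i\<close> beyond the length
  it is \<open>s\<close> itself.\<close>

definition restr :: "nat \<Rightarrow> nat \<Rightarrow> nat" where
  "restr s i = (parent ^^ (string_length s - i)) s"

lemma parent_le: "parent s \<le> s" by (simp add: parent_def)

lemma parent_funpow_le: "(parent ^^ k) s \<le> s"
  by (induction k) (auto intro: order_trans[OF parent_le])

lemma child_cases: "s \<noteq> 0 \<Longrightarrow> s = Suc (parent s + parent s) \<or> s = Suc (Suc (parent s + parent s))"
  unfolding parent_def by presburger

lemma string_length_parent: "string_length (parent s) = string_length s - 1"
  by (cases s) (simp_all add: parent_def)

lemma string_length_parent_funpow: "string_length ((parent ^^ k) s) = string_length s - k"
  by (induction k) (simp_all add: string_length_parent)

lemma string_length_restr: "i \<le> string_length s \<Longrightarrow> string_length (restr s i) = i"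
  by (simp add: restr_def string_length_parent_funpow)

text \<open>In a cut closed under exponentiation, this places every string whose length is in the
  cut into the cut.\<close>

lemma less_exp_string_length: "Suc s < 2 ^ Suc (string_length s)"
  by (induction s rule: string_length.induct) (auto simp: algebra_simps)

lemma restr_0: "restr s 0 = 0"
  using string_length_restr[of 0 s] by (cases "restr s 0") simp_all

lemma parent_restr: "i < string_length s \<Longrightarrow> parent (restr s (Suc i)) = restr s i"
  unfolding restr_def by (metis Suc_diff_Suc comp_apply funpow.simps(2))

text \<open>The last bit is the parity of the code: \<open>2 s + 1\<close> ends in 0 and
  \<open>2 s + 2\<close> ends in 1.\<close>

lemma restr_Suc:
  assumes "i < string_length s"
  shows "restr s (Suc i) =
    (if even (restr s (Suc i)) then Suc (Suc (restr s i + restr s i)) else Suc (restr s i + restr s i))"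
proof -
  have "restr s (Suc i) \<noteq> 0" using string_length_restr[of "Suc i" s] assms by (cases "restr s (Suc i)") simp_all
  from child_cases[OF this] show ?thesis unfolding parent_restr[OF assms] by (auto split: if_splits)
qed

text \<open>An internal set whose trace on the cut is a tree may contain strings with missing
  initial segments above the cut; this part of it is hereditary.\<close>

definition "tree_part T = {s. \<forall>k. (parent ^^ k) s \<in> T}"

lemma tree_part_subset: "tree_part T \<subseteq> T"
  unfolding tree_part_def by (auto dest: spec[of _ 0])

lemma restr_in_tree: "s \<in> tree_part T \<Longrightarrow> restr s i \<in> T"
  by (simp add: tree_part_def restr_def)

text \<open>\<open>y\<close> is the first ancestor of \<open>t\<close> outside \<open>T\<close>. The
  bound \<open>y \<le> t\<close> keeps it in the cut whenever \<open>t\<close> is there.\<close>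

lemma not_tree_part:
  assumes "t \<in> T" "t \<notin> tree_part T"
  shows "\<exists>y. y \<notin> T \<and> y \<le> t \<and> (Suc (y + y) \<in> T \<or> Suc (Suc (y + y)) \<in> T)"
proof -
  obtain k where k: "(parent ^^ k) t \<notin> T" using assms(2) by (auto simp: tree_part_def)
  define k0 where "k0 = (LEAST k. (parent ^^ k) t \<notin> T)"
  have k0: "(parent ^^ k0) t \<notin> T" unfolding k0_def by (rule LeastI[of "\<lambda>k. (parent ^^ k) t \<notin> T", OF k])
  with assms(1) obtain j where j: "k0 = Suc j" by (cases k0) auto
  have c: "(parent ^^ j) t \<in> T" using not_less_Least[of j "\<lambda>k. (parent ^^ k) t \<notin> T"] j k0_def by auto
  have notin: "parent ((parent ^^ j) t) \<notin> T" using k0 j by simp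
  \<comment> \<open>The root is its own parent, so it cannot be the last ancestor inside
    \<open>T\<close>.\<close>
  have "(parent ^^ j) t \<noteq> 0"
  proof
    assume "(parent ^^ j) t = 0"
    moreover from this have "parent ((parent ^^ j) t) = 0" by (simp add: parent_def)
    ultimately show False using notin c by simp
  qed
  with notin show ?thesis using child_cases[of "(parent ^^ j) t"] c parent_funpow_le[of k0 t] j
    by (intro exI[of _ "parent ((parent ^^ j) t)"]) auto
qed

section \<open>A countable restricted ultrapower of the natural numbers\<close>

text \<open>
  Each predicate \<open>P xs y\<close> below asks for a number \<open>y\<close> depending on a list \<open>xs\<close> of parameters, and the
  universe \<open>F\<close> is closed under a choice of such \<open>y\<close>. Elements of \<open>F\<close> also serve as names of internal
  finite sets, via \<open>set_decode\<close>. In the first two families the list holds the values of \<open>m\<close> number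
  variables, then the codes of \<open>m\<close> set variables, then (for comprehension) a bound.
\<close>

definition least_pred :: "fm \<Rightarrow> nat \<Rightarrow> nat list \<Rightarrow> nat \<Rightarrow> bool" where
  "least_pred \<phi> m xs y \<longleftrightarrow>
    sat std (case_nat y (\<lambda>i. xs ! i)) (\<lambda>j. set_decode (xs ! (m + j))) \<phi> \<and>
    (\<forall>z<y. \<not> sat std (case_nat z (\<lambda>i. xs ! i)) (\<lambda>j. set_decode (xs ! (m + j))) \<phi>)"

definition compr_pred :: "fm \<Rightarrow> nat \<Rightarrow> nat list \<Rightarrow> nat \<Rightarrow> bool" where
  "compr_pred \<phi> m xs y \<longleftrightarrow> set_decode y =
    {x. x < xs ! (m + m) \<and> sat std (case_nat x (\<lambda>i. xs ! i)) (\<lambda>j. set_decode (xs ! (m + j))) \<phi>}"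

definition arith_preds :: "(nat list \<Rightarrow> nat \<Rightarrow> bool) set" where
  "arith_preds =
    {\<lambda>xs y. y = 0,
     \<lambda>xs y. y = Suc (xs ! 0),
     \<lambda>xs y. y = xs ! 0 - 1,
     \<lambda>xs y. y = xs ! 0 + xs ! 1,
     \<lambda>xs y. y = xs ! 0 * xs ! 1,
     \<lambda>xs y. y = xs ! 0 - xs ! 1,
     \<lambda>xs y. y = (xs ! 0 + xs ! 1) div 2}"

text \<open>The requests made in building the cut and the bad instance: the third is answered by
  \<open>free_subblock\<close>, the fifth and sixth by \<open>block_meets_both_colours\<close>, and
  the last codes the bad instance.\<close>

definition block_preds :: "(nat list \<Rightarrow> nat \<Rightarrow> bool) set" where
  "block_preds =
    {\<lambda>xs y. y \<in> block_starts (xs ! 0) \<and> xs ! 0 \<le> y,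
     \<lambda>xs y. y = block_end (xs ! 0) (xs ! 1),
     \<lambda>xs v. v \<in> block_starts (xs ! 1 - 1) \<and> block_end (xs ! 1 - 1) (xs ! 0) \<le> v \<and>
       block_end (xs ! 1 - 1) v \<le> block_end (xs ! 1) (xs ! 0) \<and>
       (card (set_decode (xs ! 2)) \<le> xs ! 0 \<longrightarrow> set_decode (xs ! 2) \<inter> {v..<block_end (xs ! 1 - 1) v} = {}),
     \<lambda>xs w. w \<in> block_starts (xs ! 2) \<and> xs ! 0 \<le> w \<and> block_end (xs ! 2) w \<le> block_end (xs ! 1) (xs ! 0) \<and>
       set_decode (xs ! 3) \<inter> {w..<block_end (xs ! 2) w} = {},
     \<lambda>xs h. h \<in> set_decode (xs ! 2) \<inter> {xs ! 0..<block_end (Suc (xs ! 1)) (xs ! 0)} \<inter> colour (xs ! 1),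
     \<lambda>xs h. h \<in> set_decode (xs ! 2) \<inter> {xs ! 0..<block_end (Suc (xs ! 1)) (xs ! 0)} - colour (xs ! 1),
     \<lambda>xs y. set_decode y = {z. \<exists>k x. z = pairing k x \<and> k < xs ! 0 \<and> x < xs ! 1 \<and> x \<in> colour k}}"

definition string_preds :: "(nat list \<Rightarrow> nat \<Rightarrow> bool) set" where
  "string_preds =
    {\<lambda>xs y. y \<notin> set_decode (xs ! 1) \<and> y \<le> xs ! 0 \<and>
       (Suc (y + y) \<in> set_decode (xs ! 1) \<or> Suc (Suc (y + y)) \<in> set_decode (xs ! 1)),
     \<lambda>xs y. y \<in> tree_part (set_decode (xs ! 0)) \<and> (\<forall>z\<in>tree_part (set_decode (xs ! 0)). z \<le> y),
     \<lambda>xs y. y = restr (xs ! 0) (xs ! 1),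
     \<lambda>xs y. set_decode y = {i. i < string_length (xs ! 0) \<and> even (restr (xs ! 0) (Suc i))},
     \<lambda>xs y. set_decode y = {z. \<exists>i\<le>string_length (xs ! 0). z = pairing i (restr (xs ! 0) i)}}"

definition preds :: "(nat list \<Rightarrow> nat \<Rightarrow> bool) set" where
  "preds = range (\<lambda>(\<phi>, m). least_pred \<phi> m) \<union> range (\<lambda>(\<phi>, m). compr_pred \<phi> m)
    \<union> arith_preds \<union> block_preds \<union> string_preds"

lemma countable_preds: "countable preds"
  unfolding preds_def arith_preds_def block_preds_def string_preds_def by simp

text \<open>\<open>F\<close> modulo \<open>U\<close> plays the role of \<open>K\<close>, with
  \<open>id\<close> as a nonstandard element; \<open>F_choice\<close> is closure under Skolem
  functions for \<open>preds\<close>.\<close>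

locale internal_universe =
  fixes U :: "nat filter" and F :: "(nat \<Rightarrow> nat) set"
  assumes U_proper: "U \<noteq> bot" and U_free: "U \<le> sequentially"
    and U_ultra: "\<not> eventually P U \<longleftrightarrow> eventually (\<lambda>n. \<not> P n) U"
    and F_countable: "countable F" and F_id: "id \<in> F"
    and F_choice: "Q \<in> preds \<Longrightarrow> set gs \<subseteq> F \<Longrightarrow>
      \<exists>g\<in>F. \<forall>n. (\<exists>y. Q (map (\<lambda>h. h n) gs) y) \<longrightarrow> Q (map (\<lambda>h. h n) gs) (g n)"
begin

lemma U_disj: "eventually (\<lambda>n. P n \<or> Q n) U \<longleftrightarrow> eventually P U \<or> eventually Q U"
proof
  assume *: "eventually (\<lambda>n. P n \<or> Q n) U"
  show "eventually P U \<or> eventually Q U"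
  proof (rule disjCI)
    assume "\<not> eventually Q U"
    then have "eventually (\<lambda>n. \<not> Q n) U" by (simp add: U_ultra)
    with * show "eventually P U" by eventually_elim auto
  qed
qed (auto elim: eventually_mono)

lemma U_not: "eventually (\<lambda>n. \<not> P n) U \<longleftrightarrow> \<not> eventually P U"
  by (rule U_ultra[symmetric])

lemma U_imp: "eventually (\<lambda>n. P n \<longrightarrow> Q n) U \<longleftrightarrow> (eventually P U \<longrightarrow> eventually Q U)"
  unfolding imp_conv_disj U_disj U_not ..

lemma U_const: "eventually (\<lambda>n. c) U \<longleftrightarrow> c"
  using U_proper by (simp add: eventually_const)

text \<open>The existential step of Los's theorem: witnesses at almost all \<open>n\<close> combine
  to one element of \<open>F\<close>.\<close>

lemma choice:
  assumes "P \<in> preds" "set gs \<subseteq> F" "\<forall>\<^sub>F n in U. \<exists>y. P (map (\<lambda>h. h n) gs) y"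
  shows "\<exists>g\<in>F. \<forall>\<^sub>F n in U. P (map (\<lambda>h. h n) gs) (g n)"
proof -
  from F_choice[OF assms(1,2)] obtain g where g: "g \<in> F"
    "\<And>n. \<exists>y. P (map (\<lambda>h. h n) gs) y \<Longrightarrow> P (map (\<lambda>h. h n) gs) (g n)" by blast
  have "\<forall>\<^sub>F n in U. P (map (\<lambda>h. h n) gs) (g n)"
    using assms(3) by (rule eventually_mono) (rule g(2))
  with g(1) show ?thesis by blast
qed

text \<open>A request with exactly one answer determines its function at every \<open>n\<close>, not
  just modulo \<open>U\<close>.\<close>

lemma F_fun:
  assumes "(\<lambda>xs y. y = f xs) \<in> preds" "set gs \<subseteq> F"
  shows "(\<lambda>n. f (map (\<lambda>h. h n) gs)) \<in> F"
proof -
  from F_choice[OF assms] obtain g where "g \<in> F" "\<forall>n. g n = f (map (\<lambda>h. h n) gs)" by auto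
  moreover from this have "g = (\<lambda>n. f (map (\<lambda>h. h n) gs))" by auto
  ultimately show ?thesis by simp
qed

lemma preds_intros: "arith_preds \<subseteq> preds" "block_preds \<subseteq> preds" "string_preds \<subseteq> preds"
  by (auto simp: preds_def)

lemma F_zero: "(\<lambda>n. 0) \<in> F"
  using F_fun[of "\<lambda>xs. 0" "[]"] preds_intros(1) by (auto simp: arith_preds_def)

lemma F_Suc: "f \<in> F \<Longrightarrow> (\<lambda>n. Suc (f n)) \<in> F"
  using F_fun[of "\<lambda>xs. Suc (xs ! 0)" "[f]"] preds_intros(1) by (auto simp: arith_preds_def)

lemma F_pred: "f \<in> F \<Longrightarrow> (\<lambda>n. f n - 1) \<in> F"
  using F_fun[of "\<lambda>xs. xs ! 0 - 1" "[f]"] preds_intros(1) by (auto simp: arith_preds_def)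

lemma F_add: "f \<in> F \<Longrightarrow> g \<in> F \<Longrightarrow> (\<lambda>n. f n + g n) \<in> F"
  using F_fun[of "\<lambda>xs. xs ! 0 + xs ! 1" "[f, g]"] preds_intros(1) by (auto simp: arith_preds_def)

lemma F_mult: "f \<in> F \<Longrightarrow> g \<in> F \<Longrightarrow> (\<lambda>n. f n * g n) \<in> F"
  using F_fun[of "\<lambda>xs. xs ! 0 * xs ! 1" "[f, g]"] preds_intros(1) by (auto simp: arith_preds_def)

lemma F_diff: "f \<in> F \<Longrightarrow> g \<in> F \<Longrightarrow> (\<lambda>n. f n - g n) \<in> F"
  using F_fun[of "\<lambda>xs. xs ! 0 - xs ! 1" "[f, g]"] preds_intros(1) by (auto simp: arith_preds_def)

lemma F_half: "f \<in> F \<Longrightarrow> g \<in> F \<Longrightarrow> (\<lambda>n. (f n + g n) div 2) \<in> F"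
  using F_fun[of "\<lambda>xs. (xs ! 0 + xs ! 1) div 2" "[f, g]"] preds_intros(1) by (auto simp: arith_preds_def)

lemma F_block_end: "f \<in> F \<Longrightarrow> g \<in> F \<Longrightarrow> (\<lambda>n. block_end (f n) (g n)) \<in> F"
  using F_fun[of "\<lambda>xs. block_end (xs ! 0) (xs ! 1)" "[f, g]"] preds_intros(2) by (auto simp: block_preds_def)

lemma F_restr: "f \<in> F \<Longrightarrow> g \<in> F \<Longrightarrow> (\<lambda>n. restr (f n) (g n)) \<in> F"
  using F_fun[of "\<lambda>xs. restr (xs ! 0) (xs ! 1)" "[f, g]"] preds_intros(3) by (auto simp: string_preds_def)

abbreviation env :: "(nat \<Rightarrow> nat \<Rightarrow> nat) \<Rightarrow> nat \<Rightarrow> nat \<Rightarrow> nat" where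
  "env e n \<equiv> \<lambda>i. e i n"

abbreviation senv :: "(nat \<Rightarrow> nat \<Rightarrow> nat) \<Rightarrow> nat \<Rightarrow> nat \<Rightarrow> nat set" where
  "senv E n \<equiv> \<lambda>j. set_decode (E j n)"

lemma sat_params:
  assumes "m = fm_bound \<phi>"
  shows "sat std (case_nat y (\<lambda>i. (map (\<lambda>h. h n) (map e [0..<m] @ map E [0..<m] @ gs)) ! i))
      (\<lambda>j. set_decode ((map (\<lambda>h. h n) (map e [0..<m] @ map E [0..<m] @ gs)) ! (m + j))) \<phi>
    \<longleftrightarrow> sat std (case_nat y (env e n)) (senv E n) \<phi>"
  by (rule sat_cong) (use assms in \<open>auto simp: nth_append split: nat.split\<close>)

lemma least_pred_params:
  assumes "m = fm_bound \<phi>"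
  shows "least_pred \<phi> m (map (\<lambda>h. h n) (map e [0..<m] @ map E [0..<m] @ [])) y \<longleftrightarrow>
    sat std (case_nat y (env e n)) (senv E n) \<phi> \<and>
    (\<forall>z<y. \<not> sat std (case_nat z (env e n)) (senv E n) \<phi>)"
  unfolding least_pred_def sat_params[OF assms] ..

lemma compr_pred_params:
  assumes "m = fm_bound \<phi>"
  shows "compr_pred \<phi> m (map (\<lambda>h. h n) (map e [0..<m] @ map E [0..<m] @ [d])) y \<longleftrightarrow>
    set_decode y = {x. x < d n \<and> sat std (case_nat x (env e n)) (senv E n) \<phi>}"
proof -
  have "map (\<lambda>h. h n) (map e [0..<m] @ map E [0..<m] @ [d]) ! (m + m) = d n"
    by (simp add: nth_append)
  then show ?thesis unfolding compr_pred_def sat_params[OF assms] by simp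
qed

lemma least_witness:
  assumes "\<And>i. e i \<in> F" "\<And>j. E j \<in> F"
    and ev: "\<forall>\<^sub>F n in U. \<exists>y. sat std (case_nat y (env e n)) (senv E n) \<phi>"
  obtains g where "g \<in> F" "\<forall>\<^sub>F n in U. sat std (case_nat (g n) (env e n)) (senv E n) \<phi> \<and>
    (\<forall>z<g n. \<not> sat std (case_nat z (env e n)) (senv E n) \<phi>)"
proof -
  define m where "m = fm_bound \<phi>"
  let ?xs = "map e [0..<m] @ map E [0..<m] @ []"
  have "least_pred \<phi> m \<in> preds" by (auto simp: preds_def)
  moreover have "set ?xs \<subseteq> F" using assms(1,2) by auto
  moreover have "\<forall>\<^sub>F n in U. \<exists>y. least_pred \<phi> m (map (\<lambda>h. h n) ?xs) y"
    unfolding least_pred_params[OF m_def]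
    using ev by (rule eventually_mono) (rule exists_least_iff[THEN iffD1])
  ultimately have "\<exists>g\<in>F. \<forall>\<^sub>F n in U. least_pred \<phi> m (map (\<lambda>h. h n) ?xs) (g n)"
    by (rule choice)
  then show thesis using that unfolding least_pred_params[OF m_def] by blast
qed

lemma internal_comprehension:
  assumes "\<And>i. e i \<in> F" "\<And>j. E j \<in> F" "d \<in> F"
  obtains g where "g \<in> F" "\<forall>\<^sub>F n in U. set_decode (g n) =
    {x. x < d n \<and> sat std (case_nat x (env e n)) (senv E n) \<phi>}"
proof -
  define m where "m = fm_bound \<phi>"
  let ?xs = "map e [0..<m] @ map E [0..<m] @ [d]"
  have "compr_pred \<phi> m \<in> preds" by (auto simp: preds_def)
  moreover have "set ?xs \<subseteq> F" using assms by auto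
  \<comment> \<open>The bound \<open>d\<close> makes the set finite at each \<open>n\<close>, hence
    codable by a number.\<close>
  moreover have "\<forall>\<^sub>F n in U. \<exists>y. compr_pred \<phi> m (map (\<lambda>h. h n) ?xs) y"
    unfolding compr_pred_params[OF m_def]
    by (intro always_eventually allI exI, rule set_encode_inverse) simp
  ultimately have "\<exists>g\<in>F. \<forall>\<^sub>F n in U. compr_pred \<phi> m (map (\<lambda>h. h n) ?xs) (g n)"
    by (rule choice)
  then show thesis using that unfolding compr_pred_params[OF m_def] by blast
qed


text \<open>
  A condition promises a cut inside \<open>{u..<block_end p u}\<close> that is a limit of blocks of level \<open>q\<close>.
  The levels \<open>q\<close> and \<open>p\<close> are infinitely far apart. In \<open>refines\<close>, the second conjunct is responsible
  for semiregularity and the third for the failure of cohesiveness: either the set \<open>g\<close> is bounded in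
  the cut, or it meets all blocks of some level \<open>r\<close>, and hence both colours, cofinally.
\<close>

definition condition :: "(nat \<Rightarrow> nat) \<Rightarrow> (nat \<Rightarrow> nat) \<Rightarrow> (nat \<Rightarrow> nat) \<Rightarrow> bool" where
  "condition u p q \<longleftrightarrow> u \<in> F \<and> p \<in> F \<and> q \<in> F \<and> (\<forall>\<^sub>F n in U. u n \<in> block_starts (p n)) \<and>
    (\<forall>m. \<forall>\<^sub>F n in U. q n + m < p n)"

definition refines where
  "refines g u p q u' p' q' \<longleftrightarrow>
    (\<forall>\<^sub>F n in U. block_end (q n) (u n) \<le> u' n \<and> block_end (p' n) (u' n) \<le> block_end (p n) (u n) \<and>
      q n \<le> q' n \<and> p' n \<le> p n) \<and>
    ((\<forall>\<^sub>F n in U. card (set_decode (g n)) \<le> u n) \<longrightarrow>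
      (\<forall>\<^sub>F n in U. set_decode (g n) \<inter> {u' n..<block_end (p' n) (u' n)} = {})) \<and>
    ((\<forall>\<^sub>F n in U. set_decode (g n) \<inter> {u' n..<block_end (p' n) (u' n)} = {}) \<or>
      (\<exists>r\<in>F. \<forall>\<^sub>F n in U. r n < q' n \<and>
        (\<forall>w\<in>block_starts (r n). u' n \<le> w \<longrightarrow> block_end (r n) w \<le> block_end (p' n) (u' n) \<longrightarrow>
          set_decode (g n) \<inter> {w..<block_end (r n) w} \<noteq> {})))"

text \<open>
  First pass to a block of level \<open>p - 1\<close> missing \<open>g\<close> if \<open>g\<close> is small, then split the remaining
  levels at their midpoint \<open>r\<close>: either some block of level \<open>r\<close> misses \<open>g\<close> and replaces the current
  one, or all of them meet \<open>g\<close> and the lower bound \<open>q\<close> is raised to \<open>r + 1\<close>.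
\<close>

lemma refinement_exists:
  assumes "condition u p q" and g: "g \<in> F"
  shows "\<exists>u' p' q'. condition u' p' q' \<and> refines g u p q u' p' q'"
proof -
  from assms have F: "u \<in> F" "p \<in> F" "q \<in> F" and u: "\<forall>\<^sub>F n in U. u n \<in> block_starts (p n)"
    and inf: "\<And>m. \<forall>\<^sub>F n in U. q n + m < p n" by (auto simp: condition_def)
  have "\<forall>\<^sub>F n in U. \<exists>v. v \<in> block_starts (p n - 1) \<and> block_end (p n - 1) (u n) \<le> v \<and>
       block_end (p n - 1) v \<le> block_end (p n) (u n) \<and>
       (card (set_decode (g n)) \<le> u n \<longrightarrow> set_decode (g n) \<inter> {v..<block_end (p n - 1) v} = {})"
    using u inf[of 0] by eventually_elim (rule free_subblock, auto)
  then have "\<exists>v\<in>F. \<forall>\<^sub>F n in U. v n \<in> block_starts (p n - 1) \<and> block_end (p n - 1) (u n) \<le> v n \<and>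
       block_end (p n - 1) (v n) \<le> block_end (p n) (u n) \<and>
       (card (set_decode (g n)) \<le> u n \<longrightarrow> set_decode (g n) \<inter> {v n..<block_end (p n - 1) (v n)} = {})"
    using choice[of "\<lambda>xs v. v \<in> block_starts (xs ! 1 - 1) \<and> block_end (xs ! 1 - 1) (xs ! 0) \<le> v \<and>
       block_end (xs ! 1 - 1) v \<le> block_end (xs ! 1) (xs ! 0) \<and>
       (card (set_decode (xs ! 2)) \<le> xs ! 0 \<longrightarrow> set_decode (xs ! 2) \<inter> {v..<block_end (xs ! 1 - 1) v} = {})"
       "[u, p, g]"] F g preds_intros(2) by (simp add: block_preds_def numeral_2_eq_2)
  then obtain v where vF: "v \<in> F" and v: "\<forall>\<^sub>F n in U. v n \<in> block_starts (p n - 1) \<and> block_end (p n - 1) (u n) \<le> v n \<and>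
       block_end (p n - 1) (v n) \<le> block_end (p n) (u n) \<and>
       (card (set_decode (g n)) \<le> u n \<longrightarrow> set_decode (g n) \<inter> {v n..<block_end (p n - 1) (v n)} = {})"
    by blast
  define p1 where "p1 = (\<lambda>n. p n - 1)"
  define r where "r = (\<lambda>n. (p1 n + q n) div 2)"
  have p1F: "p1 \<in> F" and rF: "r \<in> F" unfolding r_def p1_def by (intro F_half F_pred F)+
  \<comment> \<open>A gap above \<open>2 * m + 6\<close> leaves, after the loss of one level, a gap
    above \<open>m\<close> on either side of the midpoint. So both halves are infinite
    again.\<close>
  have r_inf: "\<forall>\<^sub>F n in U. q n + m < r n \<and> Suc (r n) + m < p1 n" for m
    using inf[of "2 * m + 6"] by eventually_elim (auto simp: r_def p1_def)
  have le: "\<forall>\<^sub>F n in U. block_end (q n) (u n) \<le> v n \<and> q n \<le> r n \<and> r n \<le> p n \<and> p1 n \<le> p n"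
    using v r_inf[of 0]
  proof eventually_elim
    case (elim n)
    then have "block_end (q n) (u n) \<le> block_end (p n - 1) (u n)" by (intro block_end_le_mono) (auto simp: p1_def)
    with elim show ?case by (auto simp: p1_def)
  qed
  let ?miss = "\<lambda>n w. w \<in> block_starts (r n) \<and> v n \<le> w \<and> block_end (r n) w \<le> block_end (p1 n) (v n) \<and>
       set_decode (g n) \<inter> {w..<block_end (r n) w} = {}"
  show ?thesis
  proof (cases "\<forall>\<^sub>F n in U. \<exists>w. ?miss n w")
    case True
    then have "\<exists>w\<in>F. \<forall>\<^sub>F n in U. ?miss n (w n)"
      using choice[of "\<lambda>xs w. w \<in> block_starts (xs ! 2) \<and> xs ! 0 \<le> w \<and> block_end (xs ! 2) w \<le> block_end (xs ! 1) (xs ! 0) \<and>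
         set_decode (xs ! 3) \<inter> {w..<block_end (xs ! 2) w} = {}" "[v, p1, r, g]"]
        vF p1F rF g preds_intros(2) by (simp add: block_preds_def numeral_2_eq_2 numeral_3_eq_3)
    then obtain w where wF: "w \<in> F" and w: "\<forall>\<^sub>F n in U. ?miss n (w n)" by blast
    have "condition w r q"
      unfolding condition_def using wF rF F w r_inf by (simp add: eventually_conj_iff)
    moreover have "\<forall>\<^sub>F n in U. block_end (q n) (u n) \<le> w n \<and> block_end (r n) (w n) \<le> block_end (p n) (u n) \<and>
      q n \<le> q n \<and> r n \<le> p n"
      using w v le by eventually_elim (auto simp: p1_def)
    moreover have "\<forall>\<^sub>F n in U. set_decode (g n) \<inter> {w n..<block_end (r n) (w n)} = {}"
      using w by eventually_elim auto
    ultimately show ?thesis unfolding refines_def by blast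
  next
    case False
    then have miss: "\<forall>\<^sub>F n in U. \<not> (\<exists>w. ?miss n w)" by (simp only: U_not not_False_eq_True)
    have "condition v p1 (\<lambda>n. Suc (r n))"
      unfolding condition_def using vF p1F F_Suc[OF rF] F v r_inf by (simp add: eventually_conj_iff p1_def)
    moreover have "\<forall>\<^sub>F n in U. block_end (q n) (u n) \<le> v n \<and> block_end (p1 n) (v n) \<le> block_end (p n) (u n) \<and>
      q n \<le> Suc (r n) \<and> p1 n \<le> p n"
      using v le by eventually_elim (auto simp: p1_def)
    moreover have "(\<forall>\<^sub>F n in U. card (set_decode (g n)) \<le> u n) \<longrightarrow>
      (\<forall>\<^sub>F n in U. set_decode (g n) \<inter> {v n..<block_end (p1 n) (v n)} = {})"
    proof
      assume "\<forall>\<^sub>F n in U. card (set_decode (g n)) \<le> u n"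
      with v show "\<forall>\<^sub>F n in U. set_decode (g n) \<inter> {v n..<block_end (p1 n) (v n)} = {}"
        by eventually_elim (auto simp: p1_def)
    qed
    moreover have "\<forall>\<^sub>F n in U. r n < Suc (r n) \<and>
        (\<forall>w\<in>block_starts (r n). v n \<le> w \<longrightarrow> block_end (r n) w \<le> block_end (p1 n) (v n) \<longrightarrow>
          set_decode (g n) \<inter> {w..<block_end (r n) w} \<noteq> {})"
      using miss by eventually_elim blast
    ultimately show ?thesis unfolding refines_def using rF by blast
  qed
qed

text \<open>Through the pairing every element of \<open>F\<close> is listed infinitely often, so
  each set is treated after any given stage.\<close>

definition enum :: "nat \<Rightarrow> nat \<Rightarrow> nat" where
  "enum i = from_nat_into F (fst (prod_decode i))"

lemma enum_in_F: "enum i \<in> F"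
  unfolding enum_def using F_id by (intro from_nat_into) auto

lemma enum_infinitely_often: "g \<in> F \<Longrightarrow> \<exists>i\<ge>k. enum i = g"
proof -
  assume "g \<in> F"
  then obtain j where "from_nat_into F j = g" using from_nat_into_surj[OF F_countable] by blast
  then show ?thesis by (intro exI[of _ "prod_encode (j, k)"]) (simp add: enum_def le_prod_encode_2)
qed

text \<open>Dependent choice along \<open>refinement_exists\<close>. Starting at level
  \<open>id\<close> and beyond \<open>id\<close> puts \<open>id\<close> into the cut and keeps all
  levels at or below \<open>id\<close>.\<close>

lemma generic_sequence_exists:
  obtains u p q :: "nat \<Rightarrow> nat \<Rightarrow> nat" where
    "\<And>i. condition (u i) (p i) (q i)"
    "\<And>i. refines (enum i) (u i) (p i) (q i) (u (Suc i)) (p (Suc i)) (q (Suc i))"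
    "p 0 = id" "\<forall>\<^sub>F n in U. n \<le> u 0 n"
proof -
  have "\<forall>\<^sub>F n in U. \<exists>y. y \<in> block_starts n \<and> n \<le> y"
    using block_starts_unbounded by (intro always_eventually allI) blast
  then have "\<exists>u\<in>F. \<forall>\<^sub>F n in U. u n \<in> block_starts n \<and> n \<le> u n"
    using choice[of "\<lambda>xs y. y \<in> block_starts (xs ! 0) \<and> xs ! 0 \<le> y" "[id]"] F_id preds_intros(2)
    by (simp add: block_preds_def)
  then obtain u0 where u0: "u0 \<in> F" "\<forall>\<^sub>F n in U. u0 n \<in> block_starts n \<and> n \<le> u0 n" by blast
  have "\<forall>\<^sub>F n in U. m < n" for m
    using U_free eventually_gt_at_top[of m] by (rule filter_leD)
  \<comment> \<open>\<open>id\<close> exceeds every standard number because \<open>U\<close> is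
    free, so the levels 0 and \<open>id\<close> are infinitely far apart.\<close>
  then have c0: "condition u0 id (\<lambda>n. 0)"
    unfolding condition_def using u0 F_id F_zero by (auto elim: eventually_mono)
  \<comment> \<open>The clause for \<open>i = 0\<close> pins down the starting triple, which
    \<open>dependent_nat_choice\<close> alone would leave open.\<close>
  define good where "good i s \<longleftrightarrow> (case s of (u, p, q) \<Rightarrow> condition u p q) \<and> (i = 0 \<longrightarrow> s = (u0, id, \<lambda>n. 0))"
    for i :: nat and s
  define next_to where "next_to i s t \<longleftrightarrow>
      (case s of (u, p, q) \<Rightarrow> case t of (u', p', q') \<Rightarrow> refines (enum i) u p q u' p' q')"
    for i s t
  have "\<exists>s. \<forall>i. good i (s i) \<and> next_to i (s i) (s (Suc i))"
  proof (rule dependent_nat_choice)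
    show "\<exists>x. good 0 x" using c0 by (intro exI[of _ "(u0, id, \<lambda>n. 0)"]) (simp add: good_def)
  next
    fix x i assume *: "good i x"
    obtain u p q where x: "x = (u, p, q)" by (cases x)
    have "condition u p q" using * by (simp add: good_def x)
    from refinement_exists[OF this enum_in_F[of i]]
    obtain u' p' q' where "condition u' p' q'" "refines (enum i) u p q u' p' q'" by blast
    then have "good (Suc i) (u', p', q') \<and> next_to i x (u', p', q')"
      by (simp add: good_def next_to_def x)
    then show "\<exists>y. good (Suc i) y \<and> next_to i x y" by blast
  qed
  then obtain s where s: "\<And>i. good i (s i)" "\<And>i. next_to i (s i) (s (Suc i))" by blast
  show thesis
  proof (rule that[of "\<lambda>i. fst (s i)" "\<lambda>i. fst (snd (s i))" "\<lambda>i. snd (snd (s i))"])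
    fix i
    show "condition (fst (s i)) (fst (snd (s i))) (snd (snd (s i)))"
      using s(1)[of i] by (simp add: good_def case_prod_beta)
    show "refines (enum i) (fst (s i)) (fst (snd (s i))) (snd (snd (s i)))
      (fst (s (Suc i))) (fst (snd (s (Suc i)))) (snd (snd (s (Suc i))))"
      using s(2)[of i] by (simp add: next_to_def case_prod_beta)
  qed (use s(1)[of 0] u0 in \<open>auto simp: good_def elim: eventually_mono\<close>)
qed

end

section \<open>A generic semiregular cut\<close>

locale generic_cut = internal_universe U F for U F +
  fixes u p q :: "nat \<Rightarrow> nat \<Rightarrow> nat"
  assumes condition: "\<And>i. condition (u i) (p i) (q i)"
    and refines: "\<And>i. refines (enum i) (u i) (p i) (q i) (u (Suc i)) (p (Suc i)) (q (Suc i))"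
    and p_0: "p 0 = id" and u_0: "\<forall>\<^sub>F n in U. n \<le> u 0 n"
begin

abbreviation v :: "nat \<Rightarrow> nat \<Rightarrow> nat" where "v i n \<equiv> block_end (p i n) (u i n)"

lemma F_gen: "u i \<in> F" "p i \<in> F" "q i \<in> F"
  using condition[of i] by (auto simp: condition_def)

lemma u_in_block_starts: "\<forall>\<^sub>F n in U. u i n \<in> block_starts (p i n)"
  using condition[of i] by (simp add: condition_def)

lemma q_less_p: "\<forall>\<^sub>F n in U. q i n < p i n"
proof -
  have "\<forall>\<^sub>F n in U. q i n + 0 < p i n" using condition[of i] unfolding condition_def by blast
  then show ?thesis by simp
qed

lemma gen_step: "\<forall>\<^sub>F n in U. block_end (q i n) (u i n) \<le> u (Suc i) n \<and> v (Suc i) n \<le> v i n \<and>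
    q i n \<le> q (Suc i) n \<and> p (Suc i) n \<le> p i n"
  using refines[of i] unfolding refines_def by blast

text \<open>The next start lies beyond a block of level \<open>q\<close>, and already a block of
  level 0 has length \<open>2 ^ u\<close>.\<close>

lemma u_step: "\<forall>\<^sub>F n in U. u i n + 2 ^ u i n \<le> u (Suc i) n"
  using gen_step[of i]
proof eventually_elim
  case (elim n)
  then show ?case using block_end_le_mono[of 0 "q i n" "u i n"] by simp
qed

lemma gen_mono: "i \<le> j \<Longrightarrow> \<forall>\<^sub>F n in U. u i n \<le> u j n \<and> v j n \<le> v i n \<and> q i n \<le> q j n \<and> p j n \<le> p i n"
proof (induction rule: dec_induct)
  case (step j)
  from step.IH gen_step[of j] u_step[of j] show ?case by eventually_elim auto
qed simp

lemma u_less_v: "\<forall>\<^sub>F n in U. u i n < v j n"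
  using gen_mono[of i "max i j", simplified] gen_mono[of j "max i j", simplified]
  by eventually_elim (meson le_less_trans less_block_end less_le_trans)

section \<open>The cut and its closure properties\<close>

definition I :: "(nat \<Rightarrow> nat) set" where
  "I = {f \<in> F. \<exists>i. \<forall>\<^sub>F n in U. f n \<le> u i n}"

lemma I_F: "f \<in> I \<Longrightarrow> f \<in> F" by (simp add: I_def)

lemma u_in_I: "u i \<in> I" using F_gen by (auto simp: I_def intro!: exI[of _ i])

lemma I_E:
  assumes "f \<in> I" obtains i where "i \<ge> k" "\<forall>\<^sub>F n in U. f n < u i n"
proof -
  from assms obtain i where i: "\<forall>\<^sub>F n in U. f n \<le> u i n" by (auto simp: I_def)
  have "\<forall>\<^sub>F n in U. f n < u (max k (Suc i)) n"
    using i u_step[of i] gen_mono[of "Suc i" "max k (Suc i)", simplified]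
  proof eventually_elim
    case (elim n)
    have "(0::nat) < 2 ^ u i n" by simp
    with elim show ?case by linarith
  qed
  then show thesis by (rule that[rotated]) simp
qed

lemma I_down:
  assumes "f \<in> F" "g \<in> I" "\<forall>\<^sub>F n in U. f n \<le> g n"
  shows "f \<in> I"
proof -
  obtain i where "\<forall>\<^sub>F n in U. g n < u i n" using I_E[OF assms(2), of 0] by blast
  with assms(3) have "\<forall>\<^sub>F n in U. f n \<le> u i n" by eventually_elim simp
  then show ?thesis using assms(1) by (auto simp: I_def)
qed

text \<open>One step of the sequence absorbs an exponential. Closure under successor, sum and
  product follows by crude exponential bounds.\<close>

lemma I_exp:
  assumes "f \<in> F" "g \<in> I" "\<forall>\<^sub>F n in U. f n \<le> 2 ^ g n"
  shows "f \<in> I"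
proof -
  obtain i where i: "\<forall>\<^sub>F n in U. g n < u i n" using I_E[OF assms(2), of 0] by blast
  have "\<forall>\<^sub>F n in U. f n \<le> u (Suc i) n"
    using i assms(3) u_step[of i]
  proof eventually_elim
    case (elim n)
    have "(2::nat) ^ g n \<le> 2 ^ u i n" using elim by (intro power_increasing) auto
    with elim show ?case by linarith
  qed
  then show ?thesis using assms(1) by (auto simp: I_def)
qed

lemma I_add: assumes "f \<in> I" "g \<in> I" shows "(\<lambda>n. f n + g n) \<in> I"
proof -
  obtain i where i: "\<forall>\<^sub>F n in U. f n < u i n" using I_E[OF assms(1), of 0] by blast
  obtain j where j: "j \<ge> i" "\<forall>\<^sub>F n in U. g n < u j n" using I_E[OF assms(2), of i] by blast
  have "\<forall>\<^sub>F n in U. f n + g n \<le> 2 ^ Suc (u j n)"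
    using i j(2) gen_mono[OF j(1)]
  proof eventually_elim
    case (elim n)
    have "u j n < 2 ^ u j n" by simp
    with elim show ?case by (simp del: less_exp)
  qed
  moreover have "(\<lambda>n. Suc (u j n)) \<in> I"
  proof -
    have "\<forall>\<^sub>F n in U. Suc (u j n) \<le> 2 ^ u j n"
      by (intro always_eventually allI) (simp add: Suc_le_eq)
    then show ?thesis by (rule I_exp[OF F_Suc[OF F_gen(1)] u_in_I])
  qed
  ultimately show ?thesis using I_exp[OF F_add[OF assms[THEN I_F]], of "\<lambda>n. Suc (u j n)"] by blast
qed

lemma I_mult: assumes "f \<in> I" "g \<in> I" shows "(\<lambda>n. f n * g n) \<in> I"
proof (rule I_exp[OF F_mult[OF assms[THEN I_F]] I_add[OF assms]])
  have "f n * g n \<le> 2 ^ (f n + g n)" for n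
    unfolding power_add by (intro mult_le_mono less_imp_le less_exp)
  then show "\<forall>\<^sub>F n in U. f n * g n \<le> 2 ^ (f n + g n)" by simp
qed

lemma I_zero: "(\<lambda>n. 0) \<in> I"
  using F_zero by (auto simp: I_def)

lemma I_Suc: assumes "f \<in> I" shows "(\<lambda>n. Suc (f n)) \<in> I"
proof (rule I_exp[OF F_Suc[OF I_F[OF assms]] assms])
  show "\<forall>\<^sub>F n in U. Suc (f n) \<le> 2 ^ f n" by (simp add: Suc_le_eq)
qed

lemma id_in_I: "id \<in> I"
  using F_id u_0 by (auto simp: I_def)

lemma I_less_v: assumes "f \<in> I" shows "\<forall>\<^sub>F n in U. f n < v i n"
proof -
  obtain j where "\<forall>\<^sub>F n in U. f n < u j n" using I_E[OF assms, of 0] by blast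
  then show ?thesis using u_less_v[of j i] by eventually_elim simp
qed

lemma v_F: "v i \<in> F" by (intro F_block_end F_gen)

text \<open>\<open>g\<close> is treated at a stage where \<open>u\<close> has already passed
  \<open>f\<close>, so the next block misses it. Since the cut lies below every \<open>v i\<close>,
  the part of \<open>g\<close> in the cut is bounded by \<open>u i\<close>.\<close>

lemma semiregular:
  assumes "g \<in> F" "f \<in> I" "\<forall>\<^sub>F n in U. card (set_decode (g n)) \<le> f n"
  shows "\<exists>i. \<forall>\<^sub>F n in U. set_decode (g n) \<inter> {u i n..<v i n} = {}"
proof -
  obtain j where j: "\<forall>\<^sub>F n in U. f n < u j n" using I_E[OF assms(2), of 0] by blast
  obtain i where i: "i \<ge> j" "enum i = g" using enum_infinitely_often[OF assms(1)] by blast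
  have "\<forall>\<^sub>F n in U. card (set_decode (g n)) \<le> u i n"
    using assms(3) j gen_mono[OF i(1)] by eventually_elim simp
  then show ?thesis using refines[of i] i(2) unfolding refines_def by blast
qed

text \<open>A cofinal \<open>H\<close> cannot miss the block chosen at its stage, so it meets every
  block of some level \<open>r\<close> there. At each later stage \<open>k\<close> it then takes
  both colours between \<open>u k\<close> and \<open>u (Suc k)\<close>.\<close>

lemma unbounded_set_splits:
  assumes H: "H \<in> F" and cofinal: "\<And>b. b \<in> I \<Longrightarrow> \<exists>h\<in>I. \<forall>\<^sub>F n in U. b n < h n \<and> h n \<in> set_decode (H n)"
  obtains r where "r \<in> F" "\<forall>\<^sub>F n in U. r n < n"
    "\<And>b. b \<in> I \<Longrightarrow> \<exists>h\<in>I. \<forall>\<^sub>F n in U. b n < h n \<and> h n \<in> set_decode (H n) \<and> h n \<in> colour (r n)"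
    "\<And>b. b \<in> I \<Longrightarrow> \<exists>h\<in>I. \<forall>\<^sub>F n in U. b n < h n \<and> h n \<in> set_decode (H n) \<and> h n \<notin> colour (r n)"
proof -
  obtain i where i: "enum i = H" using enum_infinitely_often[OF H] by blast
  have "\<not> (\<forall>\<^sub>F n in U. set_decode (H n) \<inter> {u (Suc i) n..<v (Suc i) n} = {})"
  proof
    assume empty: "\<forall>\<^sub>F n in U. set_decode (H n) \<inter> {u (Suc i) n..<v (Suc i) n} = {}"
    obtain h where h: "h \<in> I" "\<forall>\<^sub>F n in U. u (Suc i) n < h n \<and> h n \<in> set_decode (H n)"
      using cofinal[OF u_in_I] by blast
    have "\<forall>\<^sub>F n in U. False"
      using empty h(2) I_less_v[OF h(1), of "Suc i"] by eventually_elim auto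
    then show False using U_proper by (simp add: eventually_const)
  qed
  then obtain r where rF: "r \<in> F" and r: "\<forall>\<^sub>F n in U. r n < q (Suc i) n \<and>
        (\<forall>w\<in>block_starts (r n). u (Suc i) n \<le> w \<longrightarrow> block_end (r n) w \<le> v (Suc i) n \<longrightarrow>
          set_decode (H n) \<inter> {w..<block_end (r n) w} \<noteq> {})"
    using refines[of i] i unfolding refines_def by blast
  \<comment> \<open>\<open>r < q < p\<close> at stage \<open>Suc i\<close>, and \<open>p\<close>
    never exceeds its initial value \<open>id\<close>; this makes \<open>r\<close> an index of the
    bad instance.\<close>
  have r_less: "\<forall>\<^sub>F n in U. r n < n"
    using r q_less_p[of "Suc i"] gen_mono[of 0 "Suc i", simplified] by eventually_elim (simp add: p_0)
  have split: "(\<exists>h\<in>I. \<forall>\<^sub>F n in U. b n < h n \<and> h n \<in> set_decode (H n) \<and> h n \<in> colour (r n)) \<and>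
    (\<exists>h\<in>I. \<forall>\<^sub>F n in U. b n < h n \<and> h n \<in> set_decode (H n) \<and> h n \<notin> colour (r n))" if b: "b \<in> I" for b
  proof -
    obtain k where k: "k \<ge> Suc i" "\<forall>\<^sub>F n in U. b n < u k n" using I_E[OF b] by blast
    let ?J = "\<lambda>n. set_decode (H n) \<inter> {u k n..<block_end (Suc (r n)) (u k n)}"
    have *: "\<forall>\<^sub>F n in U. (\<exists>h. h \<in> ?J n \<inter> colour (r n)) \<and> (\<exists>h. h \<in> ?J n - colour (r n)) \<and>
      block_end (Suc (r n)) (u k n) \<le> u (Suc k) n"
      using r gen_mono[OF k(1)] q_less_p[of k] u_in_block_starts[of k] gen_step[of k] u_less_v[of "Suc k" k]
    proof eventually_elim
      case (elim n)
      \<comment> \<open>Level \<open>r + 1\<close> is at most \<open>q k\<close>, and below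
        \<open>p k\<close>: thus \<open>u k\<close> starts a block of level \<open>r + 1\<close>
        that ends by \<open>u (Suc k)\<close>.\<close>
      then have rq: "Suc (r n) \<le> q k n" by linarith
      have top: "block_end (Suc (r n)) (u k n) \<le> u (Suc k) n" using block_end_le_mono[OF rq, of "u k n"] elim by linarith
      have "u k n \<in> block_starts (Suc (r n))" using block_starts_antimono[of "Suc (r n)" "p k n"] rq elim by auto
      then have "(\<exists>h. h \<in> ?J n \<inter> colour (r n)) \<and> (\<exists>h. h \<in> ?J n - colour (r n))"
        using elim top by (intro conjI block_meets_both_colours) (auto dest!: bspec)
      with top show ?case by blast
    qed
    have hit: "\<exists>h\<in>I. \<forall>\<^sub>F n in U. b n < h n \<and> h n \<in> set_decode (H n) \<and> Q n (h n)"
      if hF: "h \<in> F" and h: "\<forall>\<^sub>F n in U. h n \<in> ?J n \<and> Q n (h n)" for h Q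
    proof
      show "\<forall>\<^sub>F n in U. b n < h n \<and> h n \<in> set_decode (H n) \<and> Q n (h n)"
        using h k(2) by eventually_elim auto
      have "\<forall>\<^sub>F n in U. h n \<le> u (Suc k) n" using h * by eventually_elim auto
      then show "h \<in> I" using hF by (auto simp: I_def)
    qed
    have "\<exists>h\<in>F. \<forall>\<^sub>F n in U. h n \<in> ?J n \<inter> colour (r n)"
      using choice[of "\<lambda>xs h. h \<in> set_decode (xs ! 2) \<inter> {xs ! 0..<block_end (Suc (xs ! 1)) (xs ! 0)} \<inter> colour (xs ! 1)"
          "[u k, r, H]"] preds_intros(2) F_gen rF H * 
      by (simp add: block_preds_def numeral_2_eq_2 eventually_conj_iff)
    moreover have "\<exists>h\<in>F. \<forall>\<^sub>F n in U. h n \<in> ?J n - colour (r n)"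
      using choice[of "\<lambda>xs h. h \<in> set_decode (xs ! 2) \<inter> {xs ! 0..<block_end (Suc (xs ! 1)) (xs ! 0)} - colour (xs ! 1)"
          "[u k, r, H]"] preds_intros(2) F_gen rF H * 
      by (simp add: block_preds_def numeral_2_eq_2 eventually_conj_iff)
    ultimately show ?thesis using hit[of _ "\<lambda>n x. x \<in> colour (r n)"] hit[of _ "\<lambda>n x. x \<notin> colour (r n)"] 
      by (simp only: Int_iff Diff_iff) blast
  qed
  show thesis using that[OF rF r_less] split by blast
qed

text \<open>The classes modulo \<open>U\<close> are countably many, and infinitely many since the
  \<open>u i\<close> increase strictly; so they can be numbered by \<open>nat\<close>, the
  first-order part of the model.\<close>

lemma representatives_exist:
  obtains rep :: "nat \<Rightarrow> nat \<Rightarrow> nat" where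
    "\<And>i. rep i \<in> I" "\<And>i j. \<forall>\<^sub>F n in U. rep i n = rep j n \<Longrightarrow> i = j"
    "\<And>f. f \<in> I \<Longrightarrow> \<exists>i. \<forall>\<^sub>F n in U. f n = rep i n"
proof -
  define c where "c f = {g \<in> I. \<forall>\<^sub>F n in U. f n = g n}" for f
  have self: "f \<in> c f" if "f \<in> I" for f using that by (simp add: c_def)
  have c_eq: "c f = c g \<longleftrightarrow> (\<forall>\<^sub>F n in U. f n = g n)" if "f \<in> I" "g \<in> I" for f g
  proof
    assume "c f = c g"
    then have "g \<in> c f" using self[OF that(2)] by simp
    then show "\<forall>\<^sub>F n in U. f n = g n" by (simp add: c_def)
  next
    assume fg: "\<forall>\<^sub>F n in U. f n = g n"
    have "(\<forall>\<^sub>F n in U. f n = h n) \<longleftrightarrow> (\<forall>\<^sub>F n in U. g n = h n)" for h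
      by (rule eventually_cong[OF fg]) simp
    then show "c f = c g" by (simp add: c_def)
  qed
  have u_less: "\<forall>\<^sub>F n in U. u i n < u j n" if "i < j" for i j
    using u_step[of i] gen_mono[OF Suc_leI[OF that]]
  proof eventually_elim
    case (elim n)
    have "(0::nat) < 2 ^ u i n" by simp
    with elim show ?case by linarith
  qed
  have "inj (\<lambda>i. c (u i))"
  proof (rule injI, rule ccontr)
    fix i j assume eq: "c (u i) = c (u j)" and "i \<noteq> j"
    have "\<forall>\<^sub>F n in U. u i n = u j n" using eq c_eq[OF u_in_I u_in_I] by blast
    moreover have "\<forall>\<^sub>F n in U. u i n \<noteq> u j n"
      using u_less[of i j] u_less[of j i] \<open>i \<noteq> j\<close>
      by (cases "i < j") (auto elim: eventually_mono)
    ultimately show False by (simp add: U_not)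
  qed
  then have "infinite (range (\<lambda>i. c (u i)))" using finite_imageD by blast
  moreover have "range (\<lambda>i. c (u i)) \<subseteq> c ` I" using u_in_I by blast
  ultimately have inf: "infinite (c ` I)" using infinite_super by blast
  have "countable (c ` I)"
    using F_countable I_F by (meson countable_image countable_subset subsetI)
  then have bij: "bij_betw (from_nat_into (c ` I)) UNIV (c ` I)"
    using inf by (rule bij_betw_from_nat_into)
  define rep where "rep i = (SOME f. f \<in> I \<and> c f = from_nat_into (c ` I) i)" for i
  have rep: "rep i \<in> I \<and> c (rep i) = from_nat_into (c ` I) i" for i
  proof -
    have "from_nat_into (c ` I) i \<in> c ` I" using bij by (auto simp: bij_betw_def)
    then have "\<exists>f. f \<in> I \<and> c f = from_nat_into (c ` I) i" by auto
    then show ?thesis unfolding rep_def by (rule someI_ex)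
  qed
  show thesis
  proof
    show "rep i \<in> I" for i using rep by blast
    show "i = j" if "\<forall>\<^sub>F n in U. rep i n = rep j n" for i j
    proof -
      have "c (rep i) = c (rep j)" using that c_eq rep by blast
      then have "from_nat_into (c ` I) i = from_nat_into (c ` I) j" using rep by simp
      then show ?thesis using bij by (auto simp: bij_betw_def inj_def)
    qed
    show "\<exists>i. \<forall>\<^sub>F n in U. f n = rep i n" if f: "f \<in> I" for f
    proof -
      have "c f \<in> c ` I" using f by (rule imageI)
      then have "c f \<in> range (from_nat_into (c ` I))" by (simp only: bij_betw_imp_surj_on[OF bij])
      then obtain i where "c f = from_nat_into (c ` I) i" by (rule rangeE)
      then have "c f = c (rep i)" using rep by simp
      then show ?thesis using c_eq f rep by blast
    qed
  qed
qed

end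

section \<open>The model\<close>

locale cut_model = generic_cut U F u p q for U F u p q +
  fixes rep :: "nat \<Rightarrow> nat \<Rightarrow> nat"
  assumes rep_I: "\<And>i. rep i \<in> I"
    and rep_inj: "\<And>i j. \<forall>\<^sub>F n in U. rep i n = rep j n \<Longrightarrow> i = j"
    and rep_surj: "\<And>f. f \<in> I \<Longrightarrow> \<exists>i. \<forall>\<^sub>F n in U. f n = rep i n"
begin

definition idx :: "(nat \<Rightarrow> nat) \<Rightarrow> nat" where
  "idx f = (SOME i. \<forall>\<^sub>F n in U. f n = rep i n)"

lemma rep_F: "rep i \<in> F" by (rule I_F[OF rep_I])

lemma rep_idx: "f \<in> I \<Longrightarrow> \<forall>\<^sub>F n in U. rep (idx f) n = f n"
  using someI_ex[OF rep_surj[of f]] by (simp add: idx_def eq_commute)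

lemma rep_eq_iff: "i = j \<longleftrightarrow> (\<forall>\<^sub>F n in U. rep i n = rep j n)"
  using rep_inj by auto

text \<open>The trace on the cut of the internal finite set named by \<open>g\<close>.\<close>

definition coded_set :: "(nat \<Rightarrow> nat) \<Rightarrow> nat set" where
  "coded_set g = {i. \<forall>\<^sub>F n in U. rep i n \<in> set_decode (g n)}"

definition M :: "nat l2_structure" where
  "M = \<lparr>zero = idx (\<lambda>n. 0),
    succ = (\<lambda>i. idx (\<lambda>n. Suc (rep i n))),
    add = (\<lambda>i j. idx (\<lambda>n. rep i n + rep j n)),
    mul = (\<lambda>i j. idx (\<lambda>n. rep i n * rep j n)),
    lt = (\<lambda>i j. \<forall>\<^sub>F n in U. rep i n < rep j n),
    sets = coded_set ` F\<rparr>"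

lemma rep_zero: "\<forall>\<^sub>F n in U. rep (zero M) n = 0"
  using rep_idx[OF I_zero] by (simp add: M_def)

lemma rep_succ: "\<forall>\<^sub>F n in U. rep (succ M i) n = Suc (rep i n)"
  using rep_idx[OF I_Suc[OF rep_I]] by (simp add: M_def)

lemma rep_add: "\<forall>\<^sub>F n in U. rep (add M i j) n = rep i n + rep j n"
  using rep_idx[OF I_add[OF rep_I rep_I]] by (simp add: M_def)

lemma rep_mul: "\<forall>\<^sub>F n in U. rep (mul M i j) n = rep i n * rep j n"
  using rep_idx[OF I_mult[OF rep_I rep_I]] by (simp add: M_def)

lemma lt_M: "lt M i j \<longleftrightarrow> (\<forall>\<^sub>F n in U. rep i n < rep j n)"
  by (simp add: M_def)

lemma sets_M: "sets M = coded_set ` F"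
  by (simp add: M_def)

lemma mem_coded_set: "i \<in> coded_set g \<longleftrightarrow> (\<forall>\<^sub>F n in U. rep i n \<in> set_decode (g n))"
  by (simp add: coded_set_def)

lemma sets_env_codes:
  assumes "\<forall>j. E j \<in> sets M"
  obtains E' where "\<And>j. E' j \<in> F" "E = (\<lambda>j. coded_set (E' j))"
proof -
  from assms have "\<forall>j. \<exists>g. g \<in> F \<and> E j = coded_set g" by (auto simp: sets_M)
  from choice_iff[THEN iffD1, OF this] show thesis using that by blast
qed

section \<open>Los's theorem for bounded formulas\<close>

lemma rep_eval: "\<forall>\<^sub>F n in U. rep (eval_tm M e t) n = eval_tm std (env (\<lambda>i. rep (e i)) n) t"
proof (induction t)
  case Zero
  then show ?case using rep_zero by simp
next
  case (Succ t)
  then show ?case using rep_succ[of "eval_tm M e t"] by eventually_elim simp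
next
  case (Add t t')
  then show ?case using rep_add[of "eval_tm M e t" "eval_tm M e t'"] by eventually_elim simp
next
  case (Mul t t')
  then show ?case using rep_mul[of "eval_tm M e t" "eval_tm M e t'"] by eventually_elim simp
qed simp

lemma env_case_nat: "env (\<lambda>i. rep (case_nat a e i)) n = case_nat (rep a n) (env (\<lambda>i. rep (e i)) n)"
  by (rule ext) (simp split: nat.split)

text \<open>Set variables are traces on the left and internal sets on the right. An unbounded
  quantifier would reach beyond the cut on the right. \<open>e\<close> varies so that number
  quantifiers can be passed.\<close>

definition los :: "(nat \<Rightarrow> nat \<Rightarrow> nat) \<Rightarrow> fm \<Rightarrow> bool" where
  "los E \<phi> \<longleftrightarrow> (\<forall>e. sat M e (\<lambda>j. coded_set (E j)) \<phi> \<longleftrightarrow>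
    (\<forall>\<^sub>F n in U. sat std (env (\<lambda>i. rep (e i)) n) (senv E n) \<phi>))"

lemma losD: "los E \<phi> \<Longrightarrow> sat M e (\<lambda>j. coded_set (E j)) \<phi> \<longleftrightarrow>
    (\<forall>\<^sub>F n in U. sat std (env (\<lambda>i. rep (e i)) n) (senv E n) \<phi>)"
  by (simp add: los_def)

lemma los_case_nat: "los E \<phi> \<Longrightarrow> sat M (case_nat a e) (\<lambda>j. coded_set (E j)) \<phi> \<longleftrightarrow>
    (\<forall>\<^sub>F n in U. sat std (case_nat (rep a n) (env (\<lambda>i. rep (e i)) n)) (senv E n) \<phi>)"
  using losD[of E \<phi> "case_nat a e"] by (simp only: env_case_nat)

lemma los_Neg: "los E \<phi> \<Longrightarrow> los E (Neg \<phi>)"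
  by (simp add: los_def U_not)

text \<open>The least internal witness is at most \<open>f\<close>, and downward closure brings it
  into the cut.\<close>

lemma bounded_witness:
  assumes E: "\<And>j. E j \<in> F" and los: "los E \<phi>" and f: "f \<in> I"
    and ev: "\<forall>\<^sub>F n in U. \<exists>y\<le>f n. sat std (case_nat y (env (\<lambda>i. rep (e i)) n)) (senv E n) \<phi>"
  shows "\<exists>b. (\<forall>\<^sub>F n in U. rep b n \<le> f n) \<and> sat M (case_nat b e) (\<lambda>j. coded_set (E j)) \<phi>"
proof -
  have "\<forall>\<^sub>F n in U. \<exists>y. sat std (case_nat y (env (\<lambda>i. rep (e i)) n)) (senv E n) \<phi>"
    using ev by eventually_elim blast
  from least_witness[where e = "\<lambda>i. rep (e i)", OF rep_F E this] obtain g where g: "g \<in> F"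
    "\<forall>\<^sub>F n in U. sat std (case_nat (g n) (env (\<lambda>i. rep (e i)) n)) (senv E n) \<phi> \<and>
      (\<forall>z<g n. \<not> sat std (case_nat z (env (\<lambda>i. rep (e i)) n)) (senv E n) \<phi>)" by blast
  have le: "\<forall>\<^sub>F n in U. g n \<le> f n"
    using g(2) ev by eventually_elim (metis leI order_trans)
  then have "g \<in> I" using I_down g(1) f by blast
  from rep_idx[OF this] have eq: "\<forall>\<^sub>F n in U. rep (idx g) n = g n" .
  have "\<forall>\<^sub>F n in U. rep (idx g) n \<le> f n" using eq le by eventually_elim simp
  moreover have "\<forall>\<^sub>F n in U. sat std (case_nat (rep (idx g) n) (env (\<lambda>i. rep (e i)) n)) (senv E n) \<phi>"
    using eq g(2) by eventually_elim simp
  ultimately show ?thesis using los_case_nat[OF los] by blast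
qed

text \<open>An internal counterexample lies below the value of \<open>t\<close>, which is in the
  cut, so it cannot escape from the cut.\<close>

lemma los_bounded_forall:
  assumes E: "\<And>j. E j \<in> F" and los: "los E \<phi>"
  shows "los E (Forall (Imp (Less (Var 0) (lift_tm t)) \<phi>))"
  unfolding los_def
proof (intro allI iffI)
  fix e
  let ?T = "\<lambda>n y. sat std (case_nat y (env (\<lambda>i. rep (e i)) n)) (senv E n) \<phi>"
  have std: "sat std (env (\<lambda>i. rep (e i)) n) (senv E n) (Forall (Imp (Less (Var 0) (lift_tm t)) \<phi>)) \<longleftrightarrow>
    (\<forall>y<eval_tm std (env (\<lambda>i. rep (e i)) n) t. ?T n y)" for n
    by (simp add: eval_sub_tm)
  have M: "sat M e (\<lambda>j. coded_set (E j)) (Forall (Imp (Less (Var 0) (lift_tm t)) \<phi>)) \<longleftrightarrow>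
    (\<forall>a. (\<forall>\<^sub>F n in U. rep a n < rep (eval_tm M e t) n) \<longrightarrow> sat M (case_nat a e) (\<lambda>j. coded_set (E j)) \<phi>)"
    by (simp add: eval_sub_tm lt_M)
  {
    assume "\<forall>\<^sub>F n in U. sat std (env (\<lambda>i. rep (e i)) n) (senv E n) (Forall (Imp (Less (Var 0) (lift_tm t)) \<phi>))"
    then have *: "\<forall>\<^sub>F n in U. \<forall>y<eval_tm std (env (\<lambda>i. rep (e i)) n) t. ?T n y" by (simp only: std)
    have "sat M (case_nat a e) (\<lambda>j. coded_set (E j)) \<phi>" if "\<forall>\<^sub>F n in U. rep a n < rep (eval_tm M e t) n" for a
      unfolding los_case_nat[OF los] using * that rep_eval[of e t] by eventually_elim simp
    then show "sat M e (\<lambda>j. coded_set (E j)) (Forall (Imp (Less (Var 0) (lift_tm t)) \<phi>))" unfolding M by blast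
  next
    assume *: "sat M e (\<lambda>j. coded_set (E j)) (Forall (Imp (Less (Var 0) (lift_tm t)) \<phi>))"
    show "\<forall>\<^sub>F n in U. sat std (env (\<lambda>i. rep (e i)) n) (senv E n) (Forall (Imp (Less (Var 0) (lift_tm t)) \<phi>))"
    proof (rule ccontr)
      assume "\<not> ?thesis"
      then have "\<forall>\<^sub>F n in U. \<exists>y<eval_tm std (env (\<lambda>i. rep (e i)) n) t. \<not> ?T n y"
        unfolding std U_ultra by simp
      then have ex: "\<forall>\<^sub>F n in U. \<exists>y. sat std (case_nat y (env (\<lambda>i. rep (e i)) n)) (senv E n)
          (Conj (Less (Var 0) (lift_tm t)) (Neg \<phi>))"
        by eventually_elim (simp add: eval_sub_tm)
      obtain g where g: "g \<in> F" "\<forall>\<^sub>F n in U. sat std (case_nat (g n) (env (\<lambda>i. rep (e i)) n)) (senv E n)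
          (Conj (Less (Var 0) (lift_tm t)) (Neg \<phi>))"
        using least_witness[where e = "\<lambda>i. rep (e i)", OF rep_F E ex] by (auto simp: eventually_conj_iff)
      have g': "\<forall>\<^sub>F n in U. g n < rep (eval_tm M e t) n \<and> \<not> ?T n (g n)"
        using g(2) rep_eval[of e t] by eventually_elim (simp add: eval_sub_tm)
      have "\<forall>\<^sub>F n in U. g n \<le> rep (eval_tm M e t) n" using g' by eventually_elim simp
      then have "g \<in> I" by (rule I_down[OF g(1) rep_I])
      from rep_idx[OF this] g' have "\<forall>\<^sub>F n in U. rep (idx g) n < rep (eval_tm M e t) n \<and> \<not> ?T n (rep (idx g) n)"
        by eventually_elim simp
      moreover from this have "\<forall>\<^sub>F n in U. ?T n (rep (idx g) n)"
        using * unfolding M los_case_nat[OF los] by (auto simp: eventually_conj_iff)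
      ultimately have "\<forall>\<^sub>F n in U. False" by eventually_elim simp
      then show False by (simp add: U_const)
    qed
  }
qed

lemma los_Delta00:
  assumes E: "\<And>j. E j \<in> F"
  shows "Delta00 \<phi> \<Longrightarrow> los E \<phi>"
proof (induction rule: Delta00.induct)
  case 1
  then show ?case by (simp add: los_def U_const)
next
  case (2 t t')
  have "eval_tm M e t = eval_tm M e t' \<longleftrightarrow>
    (\<forall>\<^sub>F n in U. eval_tm std (env (\<lambda>i. rep (e i)) n) t = eval_tm std (env (\<lambda>i. rep (e i)) n) t')" for e
    unfolding rep_eq_iff[of "eval_tm M e t"]
    by (rule eventually_cong[OF eventually_conj[OF rep_eval[of e t] rep_eval[of e t']]]) auto
  then show ?case by (simp add: los_def)
next
  case (3 t t')
  have "(\<forall>\<^sub>F n in U. rep (eval_tm M e t) n < rep (eval_tm M e t') n) \<longleftrightarrow>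
    (\<forall>\<^sub>F n in U. eval_tm std (env (\<lambda>i. rep (e i)) n) t < eval_tm std (env (\<lambda>i. rep (e i)) n) t')" for e
    by (rule eventually_cong[OF eventually_conj[OF rep_eval[of e t] rep_eval[of e t']]]) auto
  then show ?case by (simp add: los_def lt_M)
next
  case (4 t j)
  have "(\<forall>\<^sub>F n in U. rep (eval_tm M e t) n \<in> set_decode (E j n)) \<longleftrightarrow>
    (\<forall>\<^sub>F n in U. eval_tm std (env (\<lambda>i. rep (e i)) n) t \<in> set_decode (E j n))" for e
    by (rule eventually_cong[OF rep_eval[of e t]]) auto
  then show ?case by (simp add: los_def mem_coded_set)
next
  case (5 \<phi> \<psi>)
  then show ?case by (simp add: los_def U_imp)
next
  case (6 \<phi> t)
  show ?case by (rule los_bounded_forall[OF E 6(2)])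
next
  case (7 \<phi> t)
  have "los E (Neg (Forall (Imp (Less (Var 0) (lift_tm t)) (Neg \<phi>))))"
    by (intro los_Neg los_bounded_forall E 7(2))
  then show ?case by (simp add: los_def)
qed

section \<open>Robinson's axioms, induction and comprehension in the model\<close>

lemma robinson_M: "sat M e E \<phi>" if "\<phi> \<in> robinson"
proof -
  have 1: "succ M x \<noteq> zero M" for x
  proof
    assume eq: "succ M x = zero M"
    have "\<forall>\<^sub>F n in U. False" using rep_succ[of x, unfolded eq] rep_zero by eventually_elim simp
    then show False by (simp add: U_const)
  qed
  have 2: "succ M x = succ M y \<longrightarrow> x = y" for x y
  proof
    assume eq: "succ M x = succ M y"
    show "x = y" by (rule rep_inj) (use rep_succ[of x, unfolded eq] rep_succ[of y] in eventually_elim, simp)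
  qed
  have 3: "\<exists>z. x = succ M z" if "x \<noteq> zero M" for x
  proof -
    from that have nz: "\<forall>\<^sub>F n in U. rep x n \<noteq> 0"
      unfolding U_not
    proof (rule contrapos_nn)
      assume "\<forall>\<^sub>F n in U. rep x n = 0"
      then have "\<forall>\<^sub>F n in U. rep x n = rep (zero M) n" using rep_zero by eventually_elim simp
      then show "x = zero M" by (rule rep_inj)
    qed
    \<comment> \<open>The predecessor, like the difference in the last axiom, lies in the cut by
      downward closure.\<close>
    let ?g = "\<lambda>n. rep x n - 1"
    have "?g \<in> I" by (rule I_down[OF F_pred[OF rep_F] rep_I[of x]]) simp
    from rep_idx[OF this] rep_succ[of "idx ?g"] nz have "\<forall>\<^sub>F n in U. rep x n = rep (succ M (idx ?g)) n"
      by eventually_elim simp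
    then show "\<exists>z. x = succ M z" using rep_inj by blast
  qed
  have 4: "add M x (zero M) = x" for x
    by (rule rep_inj) (use rep_add[of x "zero M"] rep_zero in eventually_elim, simp)
  have 5: "add M x (succ M y) = succ M (add M x y)" for x y
    by (rule rep_inj) (use rep_add[of x "succ M y"] rep_succ[of y] rep_succ[of "add M x y"] rep_add[of x y]
      in eventually_elim, simp)
  have 6: "mul M x (zero M) = zero M" for x
    by (rule rep_inj) (use rep_mul[of x "zero M"] rep_zero in eventually_elim, simp)
  have 7: "mul M x (succ M y) = add M (mul M x y) x" for x y
    by (rule rep_inj) (use rep_mul[of x "succ M y"] rep_succ[of y] rep_add[of "mul M x y" x] rep_mul[of x y]
      in eventually_elim, simp)
  have 8: "lt M x y \<longleftrightarrow> (\<exists>z. add M z (succ M x) = y)" for x y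
  proof
    assume lt: "lt M x y"
    let ?g = "\<lambda>n. rep y n - Suc (rep x n)"
    have "?g \<in> I" by (rule I_down[OF F_diff[OF rep_F F_Suc[OF rep_F]] rep_I[of y]]) simp
    from rep_idx[OF this] rep_add[of "idx ?g" "succ M x"] rep_succ[of x] lt[unfolded lt_M]
    have "\<forall>\<^sub>F n in U. rep (add M (idx ?g) (succ M x)) n = rep y n"
      by eventually_elim simp
    then show "\<exists>z. add M z (succ M x) = y" using rep_inj by blast
  next
    assume "\<exists>z. add M z (succ M x) = y"
    then obtain z where z: "y = add M z (succ M x)" by blast
    show "lt M x y" unfolding lt_M z using rep_add[of z "succ M x"] rep_succ[of x]
      by eventually_elim simp
  qed
  have "\<forall>\<phi>\<in>robinson. sat M e E \<phi>"
    unfolding sat_robinson Let_def using 1 2 3 4 5 6 7 8 by blast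
  then show ?thesis using that by blast
qed

lemma directed_M: "\<exists>c. lt M x c \<and> lt M y c"
proof -
  let ?g = "\<lambda>n. Suc (rep x n + rep y n)"
  have "?g \<in> I" by (intro I_Suc I_add rep_I)
  from rep_idx[OF this] have "lt M x (idx ?g) \<and> lt M y (idx ?g)"
    unfolding lt_M by (auto elim: eventually_mono)
  then show ?thesis ..
qed

text \<open>
  If \<open>\<exists>y. \<theta>(y, x)\<close> is the given formula, then the set \<open>Y\<close> of least witnesses for some \<open>x \<le> a\<close>
  has at most \<open>a + 1\<close> elements, so by semiregularity its part in the cut is bounded by some \<open>m\<close>. Below
  \<open>a\<close>, the formula is therefore equivalent to a bounded one, which has a least counterexample.
\<close>

lemma sat_induction_M:
  assumes "Sigma0 1 \<phi>" "\<forall>j. E j \<in> sets M"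
  shows "sat M e E (induction_ax \<phi>)"
  unfolding sat_induction_ax
proof (rule impI, rule impI, rule allI, rule ccontr)
  obtain \<theta> where \<theta>: "Delta00 \<theta>" "\<And>e E. sat M e E \<phi> \<longleftrightarrow> (\<exists>b. sat M (case_nat b e) E \<theta>)"
    using Sigma1_Pi1_normal_form(1)[OF directed_M assms(1)] by auto
  obtain E' where E': "\<And>j. E' j \<in> F" "E = (\<lambda>j. coded_set (E' j))" using sets_env_codes[OF assms(2)] by blast
  have los: "los E' \<theta>" by (rule los_Delta00[OF E'(1) \<theta>(1)])
  define T where "T n y x \<longleftrightarrow> sat std (case_nat y (case_nat x (env (\<lambda>i. rep (e i)) n))) (senv E' n) \<theta>" for n y x
  have phi: "sat M (case_nat x e) E \<phi> \<longleftrightarrow> (\<exists>b. \<forall>\<^sub>F n in U. T n (rep b n) (rep x n))" for x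
    unfolding \<theta>(2) E'(2) los_case_nat[OF los] env_case_nat T_def ..
  fix a
  assume base: "sat M (case_nat (zero M) e) E \<phi>"
    and step: "\<forall>a. sat M (case_nat a e) E \<phi> \<longrightarrow> sat M (case_nat (succ M a) e) E \<phi>"
    and fail: "\<not> sat M (case_nat a e) E \<phi>"
  \<comment> \<open>The set is truncated at \<open>v 0\<close>, which is above the whole
    cut.\<close>
  obtain Y where Y0: "Y \<in> F" "\<forall>\<^sub>F n in U. set_decode (Y n) = {b. b < v 0 n \<and>
      sat std (case_nat b (env (\<lambda>i. rep (case_nat a e i)) n)) (senv E' n) (least_values_fm \<theta>)}"
    by (rule internal_comprehension[OF rep_F E'(1) v_F[of 0]])
  note Y = Y0(1) Y0(2)[unfolded env_case_nat sat_least_values_fm, folded T_def]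
  have "\<forall>\<^sub>F n in U. card (set_decode (Y n)) \<le> Suc (rep a n)"
    using Y(2) by eventually_elim (simp only: card_least_values)
  from semiregular[OF Y(1) I_Suc[OF rep_I] this] obtain i
    where gap: "\<forall>\<^sub>F n in U. set_decode (Y n) \<inter> {u i n..<v i n} = {}" by blast
  \<comment> \<open>Witnesses in the cut are below \<open>v i\<close>, so the gap forces the least
    ones below \<open>u i\<close>. The next two facts are the two directions of replacing
    \<open>\<phi>\<close> by its version bounded by \<open>m\<close>.\<close>
  define m where "m = idx (u i)"
  have m: "\<forall>\<^sub>F n in U. rep m n = u i n" unfolding m_def by (rule rep_idx[OF u_in_I])
  have small_witness: "sat M (case_nat x e) E \<phi>" if "\<forall>\<^sub>F n in U. \<exists>y<rep m n. T n y (rep x n)" for x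
  proof -
    have "\<forall>\<^sub>F n in U. \<exists>y\<le>rep m n. sat std (case_nat y (env (\<lambda>i. rep (case_nat x e i)) n)) (senv E' n) \<theta>"
      unfolding env_case_nat T_def[symmetric] using that by eventually_elim (auto intro: less_imp_le)
    from bounded_witness[OF E'(1) los rep_I this] show ?thesis unfolding \<theta>(2) E'(2) by blast
  qed
  have witness_small: "\<forall>\<^sub>F n in U. \<exists>y<rep m n. T n y (rep x n)"
    if sat: "sat M (case_nat x e) E \<phi>" and le: "\<forall>\<^sub>F n in U. rep x n \<le> rep a n" for x
  proof -
    obtain b where b: "\<forall>\<^sub>F n in U. T n (rep b n) (rep x n)" using sat phi by blast
    show ?thesis using b le gap Y(2) m I_less_v[OF rep_I, of b i] I_less_v[OF rep_I, of b 0]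
    proof eventually_elim
      case (elim n)
      define y where "y = (LEAST y. T n y (rep x n))"
      have y: "T n y (rep x n)" "\<forall>z<y. \<not> T n z (rep x n)" "y \<le> rep b n"
        unfolding y_def using elim(1) by (auto intro: LeastI Least_le dest: not_less_Least)
      have "rep x n < Suc (rep a n)" using elim by simp
      with y elim have "y \<in> set_decode (Y n)" by (auto intro!: exI[of _ "rep x n"])
      then have "y \<notin> {u i n..<v i n}" using elim(3) by blast
      moreover have "y < v i n" using elim(6) y(3) by linarith
      ultimately have "y < rep m n" using elim(5) by simp
      then show ?case using y(1) by blast
    qed
  qed
  have ex: "\<forall>\<^sub>F n in U. \<exists>x. sat std (case_nat x (env (\<lambda>i. rep (case_nat a (case_nat m e) i)) n)) (senv E' n) (unbounded_fm \<theta>)"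
  proof -
    have "\<forall>\<^sub>F n in U. \<not> (\<exists>y<rep m n. T n y (rep a n))" using small_witness[of a] fail by (simp only: U_not) blast
    then show ?thesis unfolding env_case_nat sat_unbounded_fm T_def by eventually_elim blast
  qed
  \<comment> \<open>\<open>g\<close> is the least \<open>x \<le> a\<close> without a witness below
    \<open>m\<close>: the base case excludes 0, and its predecessor will violate the step.\<close>
  obtain g where g0: "g \<in> F" "\<forall>\<^sub>F n in U.
      sat std (case_nat (g n) (env (\<lambda>i. rep (case_nat a (case_nat m e) i)) n)) (senv E' n) (unbounded_fm \<theta>) \<and>
      (\<forall>z<g n. \<not> sat std (case_nat z (env (\<lambda>i. rep (case_nat a (case_nat m e) i)) n)) (senv E' n) (unbounded_fm \<theta>))"
    by (rule least_witness[OF rep_F E'(1) ex])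
  note g = g0(1) g0(2)[unfolded env_case_nat sat_unbounded_fm, folded T_def]
  have g_le: "\<forall>\<^sub>F n in U. g n \<le> rep a n" using g(2) by eventually_elim auto
  have gI: "g \<in> I" by (rule I_down[OF g(1) rep_I g_le])
  note rg = rep_idx[OF gI]
  have not: "\<not> sat M (case_nat (idx g) e) E \<phi>"
  proof
    assume sat: "sat M (case_nat (idx g) e) E \<phi>"
    have "\<forall>\<^sub>F n in U. rep (idx g) n \<le> rep a n" using rg g_le by eventually_elim simp
    from witness_small[OF sat this] rg g(2) have "\<forall>\<^sub>F n in U. False" by eventually_elim auto
    then show False by (simp add: U_const)
  qed
  have "idx g \<noteq> zero M" using not base by auto
  then have nz: "\<not> (\<forall>\<^sub>F n in U. g n = 0)"
  proof (rule contrapos_nn)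
    assume "\<forall>\<^sub>F n in U. g n = 0"
    then have "\<forall>\<^sub>F n in U. rep (idx g) n = rep (zero M) n" using rg rep_zero by eventually_elim simp
    then show "idx g = zero M" by (rule rep_inj)
  qed
  have hI: "(\<lambda>n. g n - 1) \<in> I" by (rule I_down[OF F_pred[OF g(1)] gI]) simp
  define h where "h = idx (\<lambda>n. g n - 1)"
  have h: "\<forall>\<^sub>F n in U. rep h n = g n - 1" unfolding h_def by (rule rep_idx[OF hI])
  have nz': "\<forall>\<^sub>F n in U. g n \<noteq> 0" using nz by (simp only: U_not not_False_eq_True)
  have "idx g = succ M h"
    by (rule rep_inj) (use rg h nz' rep_succ[of h] in eventually_elim, simp)
  moreover have "\<forall>\<^sub>F n in U. \<exists>y<rep m n. T n y (rep h n)"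
    using g(2) h nz'
  proof eventually_elim
    case (elim n)
    then have "g n - 1 < g n" "g n - 1 < Suc (rep a n)" by auto
    then show ?case using elim by metis
  qed
  ultimately show False using small_witness[of h] step not by auto
qed

text \<open>By \<open>equiv\<close>, each \<open>a\<close> has a witness in the cut for exactly one
  of \<open>\<theta>\<close> and \<open>\<eta>\<close>. The race is therefore decided inside the
  cut, whatever witnesses exist above it.\<close>

lemma sat_delta_comprehension_M:
  assumes "Sigma0 1 \<phi>" "Pi0 1 \<psi>" "\<forall>j. E j \<in> sets M"
  shows "sat M e E (delta_comprehension_ax \<phi> \<psi>)"
  unfolding sat_delta_comprehension_ax
proof
  assume equiv: "\<forall>a. sat M (case_nat a e) E \<phi> \<longleftrightarrow> sat M (case_nat a e) E \<psi>"
  obtain \<theta> where \<theta>: "Delta00 \<theta>" "\<And>e E. sat M e E \<phi> \<longleftrightarrow> (\<exists>b. sat M (case_nat b e) E \<theta>)"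
    using Sigma1_Pi1_normal_form(1)[OF directed_M assms(1)] by auto
  obtain \<eta> where \<eta>: "Delta00 \<eta>" "\<And>e E. \<not> sat M e E \<psi> \<longleftrightarrow> (\<exists>b. sat M (case_nat b e) E \<eta>)"
    using Sigma1_Pi1_normal_form(2)[OF directed_M assms(2)] by auto
  obtain E' where E': "\<And>j. E' j \<in> F" "E = (\<lambda>j. coded_set (E' j))" using sets_env_codes[OF assms(3)] by blast
  have los: "los E' \<theta>" "los E' \<eta>" by (rule los_Delta00[OF E'(1)], fact)+
  obtain g where g0: "g \<in> F" "\<forall>\<^sub>F n in U. set_decode (g n) = {x. x < v 0 n \<and>
      sat std (case_nat x (env (\<lambda>i. rep (e i)) n)) (senv E' n) (race_fm \<theta> \<eta>)}"
    by (rule internal_comprehension[OF rep_F E'(1) v_F[of 0]])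
  note g = g0(1) g0(2)[unfolded sat_race_fm]
  have "a \<in> coded_set g \<longleftrightarrow> sat M (case_nat a e) E \<phi>" for a
  proof -
    define P where "P n y \<longleftrightarrow> sat std (case_nat y (env (\<lambda>i. rep (case_nat a e i)) n)) (senv E' n) \<theta>" for n y
    define Q where "Q n y \<longleftrightarrow> sat std (case_nat y (env (\<lambda>i. rep (case_nat a e i)) n)) (senv E' n) \<eta>" for n y
    have phi: "sat M (case_nat a e) E \<phi> \<longleftrightarrow> (\<exists>b. \<forall>\<^sub>F n in U. P n (rep b n))"
      unfolding \<theta>(2) E'(2) los_case_nat[OF los(1)] P_def ..
    have psi: "\<not> sat M (case_nat a e) E \<psi> \<longleftrightarrow> (\<exists>b. \<forall>\<^sub>F n in U. Q n (rep b n))"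
      unfolding \<eta>(2) E'(2) los_case_nat[OF los(2)] Q_def ..
    have P_bounded: "sat M (case_nat a e) E \<phi>" if "\<forall>\<^sub>F n in U. \<exists>y\<le>rep b n. P n y" for b
      using bounded_witness[OF E'(1) los(1) rep_I that[unfolded P_def]] unfolding \<theta>(2) E'(2) by blast
    have Q_bounded: "\<not> sat M (case_nat a e) E \<psi>" if "\<forall>\<^sub>F n in U. \<exists>y\<le>rep b n. Q n y" for b
      using bounded_witness[OF E'(1) los(2) rep_I that[unfolded Q_def]] unfolding \<eta>(2) E'(2) by blast
    have mem: "\<forall>\<^sub>F n in U. rep a n \<in> set_decode (g n) \<longleftrightarrow> (\<exists>y. P n y \<and> (\<forall>z<y. \<not> Q n z))"
      using g(2) I_less_v[OF rep_I, of a 0] unfolding P_def Q_def env_case_nat by eventually_elim simp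
    show ?thesis
    proof
      assume "a \<in> coded_set g"
      then have in_g: "\<forall>\<^sub>F n in U. \<exists>y. P n y \<and> (\<forall>z<y. \<not> Q n z)"
        unfolding mem_coded_set using mem by eventually_elim simp
      show "sat M (case_nat a e) E \<phi>"
      proof (rule ccontr)
        assume not: "\<not> ?thesis"
        then obtain b where "\<forall>\<^sub>F n in U. Q n (rep b n)" using equiv psi by blast
        \<comment> \<open>The witness \<open>b\<close> for \<open>\<eta>\<close> bounds the winning
          witness for \<open>\<theta>\<close>, which puts it into the cut.\<close>
        with in_g have "\<forall>\<^sub>F n in U. \<exists>y\<le>rep b n. P n y" by eventually_elim (metis not_less)
        then show False using P_bounded not by blast
      qed
    next
      assume sat: "sat M (case_nat a e) E \<phi>"
      then obtain b where b: "\<forall>\<^sub>F n in U. P n (rep b n)" using phi by blast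
      \<comment> \<open>\<open>\<eta>\<close> has no internal witness up to \<open>b\<close>, so the
        witness \<open>b\<close> for \<open>\<theta>\<close> wins.\<close>
      have "\<not> (\<forall>\<^sub>F n in U. \<exists>y\<le>rep b n. Q n y)" using Q_bounded sat equiv by blast
      then have "\<forall>\<^sub>F n in U. \<not> (\<exists>y\<le>rep b n. Q n y)" by (simp only: U_not not_False_eq_True)
      with b mem show "a \<in> coded_set g" unfolding mem_coded_set by eventually_elim (metis less_imp_le)
    qed
  qed
  then show "\<exists>A\<in>sets M. \<forall>a. a \<in> A \<longleftrightarrow> sat M (case_nat a e) E \<phi>"
    using g(1) by (auto simp: sets_M)
qed

section \<open>Failure of FinCOH in the model\<close>

lemma coded_set_mem_idx: "f \<in> I \<Longrightarrow> idx f \<in> coded_set g \<longleftrightarrow> (\<forall>\<^sub>F n in U. f n \<in> set_decode (g n))"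
  unfolding mem_coded_set by (rule eventually_cong[OF rep_idx]) auto

lemma not_FinCOH_M: "\<not> M \<Turnstile> FinCOH"
proof
  assume "M \<Turnstile> FinCOH"
  \<comment> \<open>\<open>FinCOH\<close> is a sentence, so any environment with values in the model
    will do.\<close>
  then have "(\<forall>j::nat. coded_set id \<in> sets M) \<longrightarrow> sat M (\<lambda>_. 0) (\<lambda>_. coded_set id) FinCOH"
    unfolding valid_in_def by (elim allE)
  then have sat: "sat M (\<lambda>_. 0) (\<lambda>_. coded_set id) FinCOH" using F_id by (simp add: sets_M)
  define pr where "pr x y = add M (mul M (add M x y) (add M x y)) x" for x y
  have rep_pr: "\<forall>\<^sub>F n in U. rep (pr x y) n = pairing (rep x n) (rep y n)" for x y
    unfolding pr_def using rep_add[of "mul M (add M x y) (add M x y)" x]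
      rep_mul[of "add M x y" "add M x y"] rep_add[of x y] by eventually_elim simp
  \<comment> \<open>The instance has nonstandard length \<open>id\<close>. Truncation at
    \<open>v 0\<close>, above the cut, makes it finite at each \<open>n\<close> without changing its
    trace.\<close>
  have "\<exists>R\<in>F. \<forall>\<^sub>F n in U. set_decode (R n) = {z. \<exists>k x. z = pairing k x \<and> k < n \<and> x < v 0 n \<and> x \<in> colour k}"
  proof -
    have fin: "finite {z. \<exists>k x. z = pairing k x \<and> k < n \<and> x < d \<and> x \<in> colour k}" for n d
      by (rule finite_subset[of _ "(\<lambda>(k, x). pairing k x) ` ({..<n} \<times> {..<d})"]) auto
    have "\<forall>\<^sub>F n in U. \<exists>y. set_decode y = {z. \<exists>k x. z = pairing k x \<and> k < n \<and> x < v 0 n \<and> x \<in> colour k}"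
      by (intro always_eventually allI exI, rule set_encode_inverse[OF fin])
    then show ?thesis
      using choice[of "\<lambda>xs y. set_decode y = {z. \<exists>k x. z = pairing k x \<and> k < xs ! 0 \<and> x < xs ! 1 \<and> x \<in> colour k}"
        "[id, v 0]"] F_id v_F[of 0] preds_intros(2) by (simp add: block_preds_def)
  qed
  then obtain R where R: "R \<in> F" "\<forall>\<^sub>F n in U. set_decode (R n) = {z. \<exists>k x. z = pairing k x \<and> k < n \<and> x < v 0 n \<and> x \<in> colour k}"
    by blast
  have "coded_set R \<in> sets M" using R(1) by (auto simp: sets_M)
  with sat[unfolded sat_FinCOH, folded pr_def] obtain A where "A \<in> sets M"
    and A: "\<forall>b. \<exists>x. lt M b x \<and> x \<in> A"
      "\<forall>k. lt M k (idx id) \<longrightarrow>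
        (\<exists>b. \<forall>x. lt M b x \<longrightarrow> x \<in> A \<longrightarrow> pr k x \<in> coded_set R) \<or>
        (\<exists>b. \<forall>x. lt M b x \<longrightarrow> x \<in> A \<longrightarrow> pr k x \<notin> coded_set R)" by blast
  then obtain H where H: "H \<in> F" "A = coded_set H" by (auto simp: sets_M)
  have cofinal: "\<exists>h\<in>I. \<forall>\<^sub>F n in U. b n < h n \<and> h n \<in> set_decode (H n)" if b: "b \<in> I" for b
  proof -
    obtain x where x: "lt M (idx b) x" "x \<in> coded_set H" using A(1) H(2) by blast
    have "\<forall>\<^sub>F n in U. b n < rep x n \<and> rep x n \<in> set_decode (H n)"
      using rep_idx[OF b] x[unfolded lt_M mem_coded_set] by eventually_elim simp
    then show ?thesis using rep_I by blast
  qed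
  obtain r where r: "r \<in> F" "\<forall>\<^sub>F n in U. r n < n"
    and r_in: "\<And>b. b \<in> I \<Longrightarrow> \<exists>h\<in>I. \<forall>\<^sub>F n in U. b n < h n \<and> h n \<in> set_decode (H n) \<and> h n \<in> colour (r n)"
    and r_out: "\<And>b. b \<in> I \<Longrightarrow> \<exists>h\<in>I. \<forall>\<^sub>F n in U. b n < h n \<and> h n \<in> set_decode (H n) \<and> h n \<notin> colour (r n)"
    using unbounded_set_splits[OF H(1) cofinal] by blast
  have "\<forall>\<^sub>F n in U. r n \<le> id n" using r(2) by eventually_elim simp
  then have rI: "r \<in> I" by (rule I_down[OF r(1) id_in_I])
  define k where "k = idx r"
  have k: "\<forall>\<^sub>F n in U. rep k n = r n" unfolding k_def by (rule rep_idx[OF rI])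
  have lt_k: "lt M k (idx id)"
    unfolding lt_M using k r(2) rep_idx[OF id_in_I] by eventually_elim simp
  have mem_R: "\<forall>\<^sub>F n in U. rep (pr k x) n \<in> set_decode (R n) \<longleftrightarrow> rep x n \<in> colour (r n)" for x
    using R(2) rep_pr[of k x] k r(2) I_less_v[OF rep_I, of x 0]
    by eventually_elim (auto simp: pairing_inj)
  have lt_idx: "lt M b (idx h)" and mem_idx: "idx h \<in> A" and rep_h: "\<forall>\<^sub>F n in U. rep (idx h) n = h n"
    if "h \<in> I" "\<forall>\<^sub>F n in U. rep b n < h n" "\<forall>\<^sub>F n in U. h n \<in> set_decode (H n)" for b h
  proof -
    show rep_h: "\<forall>\<^sub>F n in U. rep (idx h) n = h n" by (rule rep_idx[OF that(1)])
    show "lt M b (idx h)" unfolding lt_M using rep_h that(2) by eventually_elim simp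
    show "idx h \<in> A" unfolding H(2) using coded_set_mem_idx[OF that(1)] that(3) by blast
  qed
  from A(2) lt_k consider
    b where "\<forall>x. lt M b x \<longrightarrow> x \<in> A \<longrightarrow> pr k x \<in> coded_set R"
    | b where "\<forall>x. lt M b x \<longrightarrow> x \<in> A \<longrightarrow> pr k x \<notin> coded_set R" by blast
  then show False
  proof cases
    case 1
    obtain h where h: "h \<in> I" "\<forall>\<^sub>F n in U. rep b n < h n" "\<forall>\<^sub>F n in U. h n \<in> set_decode (H n)"
      "\<forall>\<^sub>F n in U. h n \<notin> colour (r n)" using r_out[OF rep_I[of b]] by (auto simp: eventually_conj_iff)
    have "pr k (idx h) \<in> coded_set R" using 1 lt_idx[OF h(1-3)] mem_idx[OF h(1-3)] by blast
    then have "\<forall>\<^sub>F n in U. False" unfolding mem_coded_set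
      using mem_R[of "idx h"] rep_h[OF h(1-3)] h(4) by eventually_elim simp
    then show False by (simp add: U_const)
  next
    case 2
    obtain h where h: "h \<in> I" "\<forall>\<^sub>F n in U. rep b n < h n" "\<forall>\<^sub>F n in U. h n \<in> set_decode (H n)"
      "\<forall>\<^sub>F n in U. h n \<in> colour (r n)" using r_in[OF rep_I[of b]] by (auto simp: eventually_conj_iff)
    have "pr k (idx h) \<notin> coded_set R" using 2 lt_idx[OF h(1-3)] mem_idx[OF h(1-3)] by blast
    moreover have "pr k (idx h) \<in> coded_set R" unfolding mem_coded_set
      using mem_R[of "idx h"] rep_h[OF h(1-3)] h(4) by eventually_elim simp
    ultimately show False by blast
  qed
qed

section \<open>Weak Koenig's lemma in the model\<close>

lemma tree_part_I:
  assumes T: "t \<in> F"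
    and tree: "\<And>s. succ M (add M s s) \<in> coded_set t \<or> succ M (succ M (add M s s)) \<in> coded_set t \<Longrightarrow> s \<in> coded_set t"
    and f: "f \<in> I" "\<forall>\<^sub>F n in U. f n \<in> set_decode (t n)"
  shows "\<forall>\<^sub>F n in U. f n \<in> tree_part (set_decode (t n))"
proof (rule ccontr)
  assume "\<not> ?thesis"
  then have "\<forall>\<^sub>F n in U. f n \<notin> tree_part (set_decode (t n))" by (simp only: U_not not_False_eq_True)
  with f(2) have "\<forall>\<^sub>F n in U. \<exists>y. y \<notin> set_decode (t n) \<and> y \<le> f n \<and>
    (Suc (y + y) \<in> set_decode (t n) \<or> Suc (Suc (y + y)) \<in> set_decode (t n))"
    by eventually_elim (rule not_tree_part)
  then have "\<exists>y\<in>F. \<forall>\<^sub>F n in U. y n \<notin> set_decode (t n) \<and> y n \<le> f n \<and>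
    (Suc (y n + y n) \<in> set_decode (t n) \<or> Suc (Suc (y n + y n)) \<in> set_decode (t n))"
    using choice[of "\<lambda>xs y. y \<notin> set_decode (xs ! 1) \<and> y \<le> xs ! 0 \<and>
       (Suc (y + y) \<in> set_decode (xs ! 1) \<or> Suc (Suc (y + y)) \<in> set_decode (xs ! 1))" "[f, t]"]
      I_F[OF f(1)] T preds_intros(3) by (simp add: string_preds_def)
  then obtain y where y: "y \<in> F" "\<forall>\<^sub>F n in U. y n \<notin> set_decode (t n)" "\<forall>\<^sub>F n in U. y n \<le> f n"
    "\<forall>\<^sub>F n in U. Suc (y n + y n) \<in> set_decode (t n) \<or> Suc (Suc (y n + y n)) \<in> set_decode (t n)"
    by (auto simp: eventually_conj_iff)
  \<comment> \<open>\<open>y \<le> f\<close> brings the defect found by \<open>not_tree_part\<close>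
    into the cut, where the coded set is a tree.\<close>
  have yI: "y \<in> I" by (rule I_down[OF y(1) f(1) y(3)])
  define s where "s = idx y"
  have s: "\<forall>\<^sub>F n in U. rep s n = y n" unfolding s_def by (rule rep_idx[OF yI])
  have s0: "\<forall>\<^sub>F n in U. rep (succ M (add M s s)) n = Suc (y n + y n)"
    using rep_succ[of "add M s s"] rep_add[of s s] s by eventually_elim simp
  have s1: "\<forall>\<^sub>F n in U. rep (succ M (succ M (add M s s))) n = Suc (Suc (y n + y n))"
    using rep_succ[of "succ M (add M s s)"] s0 by eventually_elim simp
  have "succ M (add M s s) \<in> coded_set t \<or> succ M (succ M (add M s s)) \<in> coded_set t"
    unfolding mem_coded_set U_disj[symmetric] using y(4) s0 s1 by eventually_elim simp
  then have "s \<in> coded_set t" by (rule tree)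
  then have "\<forall>\<^sub>F n in U. False" unfolding mem_coded_set using s y(2) by eventually_elim simp
  then show False by (simp add: U_const)
qed

text \<open>
  The largest internal string \<open>s\<close> all of whose initial segments lie in the tree is above the cut, so
  its restrictions to lengths in the cut form a path.
\<close>

lemma WKL_M: "sat M e E WKL"
  unfolding sat_WKL
proof (intro ballI impI)
  define pr where "pr x y = add M (mul M (add M x y) (add M x y)) x" for x y
  have rep_pr: "\<forall>\<^sub>F n in U. rep (pr x y) n = pairing (rep x n) (rep y n)" for x y
    unfolding pr_def using rep_add[of "mul M (add M x y) (add M x y)" x]
      rep_mul[of "add M x y" "add M x y"] rep_add[of x y] by eventually_elim simp
  define s0 where "s0 s = succ M (add M s s)" for s
  define s1 where "s1 s = succ M (s0 s)" for s
  have rep_s0: "\<forall>\<^sub>F n in U. rep (s0 s) n = Suc (rep s n + rep s n)" for s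
    unfolding s0_def using rep_succ[of "add M s s"] rep_add[of s s] by eventually_elim simp
  have rep_s1: "\<forall>\<^sub>F n in U. rep (s1 s) n = Suc (Suc (rep s n + rep s n))" for s
    unfolding s1_def using rep_succ[of "s0 s"] rep_s0[of s] by eventually_elim simp
  fix A assume "A \<in> sets M"
  then obtain t where t: "t \<in> F" "A = coded_set t" by (auto simp: sets_M)
  assume *: "(\<forall>s. succ M (add M s s) \<in> A \<or> succ M (succ M (add M s s)) \<in> A \<longrightarrow> s \<in> A) \<and>
    (\<forall>b. \<exists>x. lt M b x \<and> x \<in> A)"
  have tree: "s \<in> coded_set t"
    if "succ M (add M s s) \<in> coded_set t \<or> succ M (succ M (add M s s)) \<in> coded_set t" for s
    using *[THEN conjunct1, THEN spec[of _ s]] that unfolding t(2) by (rule mp)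
  have unb: "\<exists>x. lt M b x \<and> x \<in> coded_set t" for b
    using *[THEN conjunct2, THEN spec[of _ b]] unfolding t(2) .
  have part: "\<forall>\<^sub>F n in U. f n \<in> tree_part (set_decode (t n))"
    if "f \<in> I" "\<forall>\<^sub>F n in U. f n \<in> set_decode (t n)" for f
    using t(1) tree that by (rule tree_part_I)
  have "\<forall>\<^sub>F n in U. \<exists>y. y \<in> tree_part (set_decode (t n)) \<and> (\<forall>z\<in>tree_part (set_decode (t n)). z \<le> y)"
  proof -
    obtain x where "x \<in> coded_set t" using unb by blast
    then have "\<forall>\<^sub>F n in U. rep x n \<in> tree_part (set_decode (t n))" using part[OF rep_I] by (simp add: mem_coded_set)
    then show ?thesis
    proof eventually_elim
      case (elim n)
      have "finite (tree_part (set_decode (t n)))" by (rule finite_subset[OF tree_part_subset]) simp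
      with elim show ?case by (intro exI[of _ "Max (tree_part (set_decode (t n)))"]) (auto intro: Max_in)
    qed
  qed
  then have "\<exists>s\<in>F. \<forall>\<^sub>F n in U. s n \<in> tree_part (set_decode (t n)) \<and> (\<forall>z\<in>tree_part (set_decode (t n)). z \<le> s n)"
    using choice[of "\<lambda>xs y. y \<in> tree_part (set_decode (xs ! 0)) \<and> (\<forall>z\<in>tree_part (set_decode (xs ! 0)). z \<le> y)" "[t]"]
      t(1) preds_intros(3) by (simp add: string_preds_def)
  then obtain s where s: "s \<in> F"
    "\<forall>\<^sub>F n in U. s n \<in> tree_part (set_decode (t n)) \<and> (\<forall>z\<in>tree_part (set_decode (t n)). z \<le> s n)" by blast
  \<comment> \<open>Otherwise unboundedness would give an element of the tree in the cut above
    \<open>s\<close>, and it would belong to the tree part as well.\<close>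
  have s_notin: "s \<notin> I"
  proof
    assume "s \<in> I"
    obtain x where x: "lt M (idx s) x" "x \<in> coded_set t" using unb by blast
    have "\<forall>\<^sub>F n in U. rep x n \<in> tree_part (set_decode (t n))" using part[OF rep_I] x(2) by (simp add: mem_coded_set)
    then have "\<forall>\<^sub>F n in U. False"
      using s(2) x(1)[unfolded lt_M] rep_idx[OF \<open>s \<in> I\<close>]
    proof eventually_elim
      case (elim n)
      then have "rep x n \<le> s n" by blast
      with elim(3,4) show ?case by linarith
    qed
    then show False by (simp add: U_const)
  qed
  \<comment> \<open>If the length were at most \<open>k\<close>, the code would be below
    \<open>2 ^ (k + 1)\<close> and \<open>s\<close> would lie in the cut.\<close>
  have long: "\<forall>\<^sub>F n in U. k n < string_length (s n)" if k: "k \<in> I" for k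
  proof (rule ccontr)
    assume "\<not> ?thesis"
    then have "\<forall>\<^sub>F n in U. \<not> k n < string_length (s n)" by (simp only: U_not not_False_eq_True)
    then have "\<forall>\<^sub>F n in U. s n \<le> 2 ^ Suc (k n)"
    proof eventually_elim
      case (elim n)
      have "Suc (s n) < 2 ^ Suc (string_length (s n))" by (rule less_exp_string_length)
      also have "\<dots> \<le> 2 ^ Suc (k n)" using elim by (intro power_increasing) auto
      finally show ?case by simp
    qed
    then have "s \<in> I" by (rule I_exp[OF s(1) I_Suc[OF k]])
    with s_notin show False ..
  qed
  have restr_I: "(\<lambda>n. restr (s n) (k n)) \<in> I" if k: "k \<in> I" for k
  proof (rule I_exp[OF F_restr[OF s(1) I_F[OF k]] I_Suc[OF k]])
    show "\<forall>\<^sub>F n in U. restr (s n) (k n) \<le> 2 ^ Suc (k n)"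
      using long[OF k]
    proof eventually_elim
      case (elim n)
      then show ?case using less_exp_string_length[of "restr (s n) (k n)"] by (simp add: string_length_restr)
    qed
  qed
  have "\<forall>\<^sub>F n in U. \<exists>y. set_decode y = {i. i < string_length (s n) \<and> even (restr (s n) (Suc i))}"
    by (intro always_eventually allI exI, rule set_encode_inverse) simp
  then have "\<exists>g\<in>F. \<forall>\<^sub>F n in U. set_decode (g n) = {i. i < string_length (s n) \<and> even (restr (s n) (Suc i))}"
    using choice[of "\<lambda>xs y. set_decode y = {i. i < string_length (xs ! 0) \<and> even (restr (xs ! 0) (Suc i))}" "[s]"]
      s(1) preds_intros(3) by (simp add: string_preds_def)
  \<comment> \<open>Bit \<open>i\<close> of \<open>s\<close> is the last bit of its restriction to
    length \<open>i + 1\<close>; it is 1 exactly when that code is even.\<close>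
  then obtain gx where gx: "gx \<in> F" "\<forall>\<^sub>F n in U. set_decode (gx n) = {i. i < string_length (s n) \<and> even (restr (s n) (Suc i))}"
    by blast
  have "\<forall>\<^sub>F n in U. \<exists>y. set_decode y = {z. \<exists>i\<le>string_length (s n). z = pairing i (restr (s n) i)}"
    by (intro always_eventually allI exI, rule set_encode_inverse) simp
  then have "\<exists>g\<in>F. \<forall>\<^sub>F n in U. set_decode (g n) = {z. \<exists>i\<le>string_length (s n). z = pairing i (restr (s n) i)}"
    using choice[of "\<lambda>xs y. set_decode y = {z. \<exists>i\<le>string_length (xs ! 0). z = pairing i (restr (xs ! 0) i)}" "[s]"]
      s(1) preds_intros(3) by (simp add: string_preds_def)
  then obtain gp where gp: "gp \<in> F" "\<forall>\<^sub>F n in U. set_decode (gp n) = {z. \<exists>i\<le>string_length (s n). z = pairing i (restr (s n) i)}"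
    by blast
  have mem_X: "i \<in> coded_set gx \<longleftrightarrow> (\<forall>\<^sub>F n in U. even (restr (s n) (Suc (rep i n))))" for i
    unfolding mem_coded_set by (rule eventually_cong[OF eventually_conj[OF gx(2) long[OF rep_I[of i]]]]) auto
  have mem_P: "pr i j \<in> coded_set gp \<longleftrightarrow> (\<forall>\<^sub>F n in U. rep j n = restr (s n) (rep i n))" for i j
    unfolding mem_coded_set
    by (rule eventually_cong[OF eventually_conj[OF gp(2) eventually_conj[OF long[OF rep_I[of i]] rep_pr[of i j]]]])
      (auto simp: pairing_inj)
  have mem_P_succ: "pr (succ M i) j \<in> coded_set gp \<longleftrightarrow> (\<forall>\<^sub>F n in U. rep j n = restr (s n) (Suc (rep i n)))" for i j
    unfolding mem_P by (rule eventually_cong[OF rep_succ[of i]]) auto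
  have mem_nX: "i \<notin> coded_set gx \<longleftrightarrow> (\<forall>\<^sub>F n in U. odd (restr (s n) (Suc (rep i n))))" for i
    unfolding mem_X U_not ..
  have P0: "pr (zero M) j \<in> coded_set gp \<longleftrightarrow> j = zero M" for j
    unfolding mem_P rep_eq_iff[of j] by (rule eventually_cong[OF rep_zero]) (auto simp: restr_0)
  have P1: "\<exists>r. pr i r \<in> coded_set gp \<and> (i \<notin> coded_set gx \<and> j = s0 r \<or> i \<in> coded_set gx \<and> j = s1 r)"
    if "pr (succ M i) j \<in> coded_set gp" for i j
  proof -
    define r where "r = idx (\<lambda>n. restr (s n) (rep i n))"
    have r: "\<forall>\<^sub>F n in U. rep r n = restr (s n) (rep i n)"
      unfolding r_def by (rule rep_idx[OF restr_I[OF rep_I]])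
    note j = that[unfolded mem_P_succ]
    have "j = s0 r" if i: "i \<notin> coded_set gx"
    proof (rule rep_inj)
      show "\<forall>\<^sub>F n in U. rep j n = rep (s0 r) n"
        using i[unfolded mem_nX] j r rep_s0[of r] long[OF rep_I[of i]]
      proof eventually_elim
        case (elim n)
        then show ?case using restr_Suc[of "rep i n" "s n"] by simp
      qed
    qed
    moreover have "j = s1 r" if i: "i \<in> coded_set gx"
    proof (rule rep_inj)
      show "\<forall>\<^sub>F n in U. rep j n = rep (s1 r) n"
        using i[unfolded mem_X] j r rep_s1[of r] long[OF rep_I[of i]]
      proof eventually_elim
        case (elim n)
        then show ?case using restr_Suc[of "rep i n" "s n"] by simp
      qed
    qed
    ultimately show ?thesis using r unfolding mem_P by blast
  qed
  have P2: "pr (succ M i) j \<in> coded_set gp"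
    if "pr i r \<in> coded_set gp" "i \<notin> coded_set gx \<and> j = s0 r \<or> i \<in> coded_set gx \<and> j = s1 r" for i j r
    using that(2)
  proof (elim disjE conjE)
    assume i: "i \<notin> coded_set gx" and j: "j = s0 r"
    show ?thesis unfolding mem_P_succ j
      using that(1)[unfolded mem_P] rep_s0[of r] long[OF rep_I[of i]] i[unfolded mem_nX]
    proof eventually_elim
      case (elim n)
      then show ?case using restr_Suc[of "rep i n" "s n"] by simp
    qed
  next
    assume i: "i \<in> coded_set gx" and j: "j = s1 r"
    show ?thesis unfolding mem_P_succ j
      using that(1)[unfolded mem_P] rep_s1[of r] long[OF rep_I[of i]] i[unfolded mem_X]
    proof eventually_elim
      case (elim n)
      then show ?case using restr_Suc[of "rep i n" "s n"] by simp
    qed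
  qed
  have P3: "j \<in> A" if "pr i j \<in> coded_set gp" for i j
    unfolding t(2) mem_coded_set using that[unfolded mem_P] s(2) by eventually_elim (simp add: restr_in_tree)
  show "\<exists>X\<in>sets M. \<exists>P\<in>sets M.
        (\<forall>s. add M (mul M (add M (zero M) s) (add M (zero M) s)) (zero M) \<in> P \<longleftrightarrow> s = zero M) \<and>
        (\<forall>n s. add M (mul M (add M (succ M n) s) (add M (succ M n) s)) (succ M n) \<in> P \<longleftrightarrow>
          (\<exists>r. add M (mul M (add M n r) (add M n r)) n \<in> P \<and>
            (n \<notin> X \<and> s = succ M (add M r r) \<or> n \<in> X \<and> s = succ M (succ M (add M r r))))) \<and>
        (\<forall>n s. add M (mul M (add M n s) (add M n s)) n \<in> P \<longrightarrow> s \<in> A)"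
    unfolding pr_def[symmetric] s0_def[symmetric] s1_def[symmetric]
  proof (rule bexI[of _ "coded_set gx"], rule bexI[of _ "coded_set gp"], intro conjI allI)
    show "coded_set gx \<in> sets M" "coded_set gp \<in> sets M" using gx(1) gp(1) by (auto simp: sets_M)
    fix i j
    show "pr (zero M) j \<in> coded_set gp \<longleftrightarrow> j = zero M" by (rule P0)
    show "pr (succ M i) j \<in> coded_set gp \<longleftrightarrow>
      (\<exists>r. pr i r \<in> coded_set gp \<and> (i \<notin> coded_set gx \<and> j = s0 r \<or> i \<in> coded_set gx \<and> j = s1 r))"
    proof
      assume "pr (succ M i) j \<in> coded_set gp"
      then show "\<exists>r. pr i r \<in> coded_set gp \<and> (i \<notin> coded_set gx \<and> j = s0 r \<or> i \<in> coded_set gx \<and> j = s1 r)" by (rule P1)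
    next
      assume "\<exists>r. pr i r \<in> coded_set gp \<and> (i \<notin> coded_set gx \<and> j = s0 r \<or> i \<in> coded_set gx \<and> j = s1 r)"
      then obtain r where "pr i r \<in> coded_set gp" "i \<notin> coded_set gx \<and> j = s0 r \<or> i \<in> coded_set gx \<and> j = s1 r" by blast
      then show "pr (succ M i) j \<in> coded_set gp" by (rule P2)
    qed
    show "pr i j \<in> coded_set gp \<longrightarrow> j \<in> A" using P3 by blast
  qed
qed

lemma model_of_WKL0: "model_of M WKL0"
proof -
  have "sat M e E \<phi>" if E: "\<forall>j. E j \<in> sets M" and \<phi>: "\<phi> \<in> WKL0" for e E \<phi>
  proof -
    from \<phi> consider "\<phi> \<in> robinson" | \<chi> where "\<phi> = induction_ax \<chi>" "Sigma0 1 \<chi>"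
      | \<chi> \<psi> where "\<phi> = delta_comprehension_ax \<chi> \<psi>" "Sigma0 1 \<chi>" "Pi0 1 \<psi>" | "\<phi> = WKL"
      unfolding WKL0_def RCA0_def by blast
    then show ?thesis
      by cases (simp_all only: robinson_M sat_induction_M[OF _ E] sat_delta_comprehension_M[OF _ _ E] WKL_M)
  qed
  moreover have "sets M \<noteq> {}" using F_id by (auto simp: sets_M)
  ultimately show ?thesis unfolding model_of_def valid_in_def by blast
qed

end

theorem corollary3p3:
  shows "\<not> WKL0 \<turnstile> FinCOH \<and>
    (\<exists>M :: nat l2_structure. model_of M WKL0 \<and> \<not> M \<Turnstile> FinCOH)"
proof -
  obtain U :: "nat filter" where U: "U \<noteq> bot" "U \<le> sequentially"
    "\<And>P. \<not> eventually P U \<longleftrightarrow> eventually (\<lambda>n. \<not> P n) U" using exists_ultrafilter by blast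
  obtain F :: "(nat \<Rightarrow> nat) set" where F: "countable F" "id \<in> F"
    "\<And>P gs. P \<in> preds \<Longrightarrow> set gs \<subseteq> F \<Longrightarrow>
      \<exists>g\<in>F. \<forall>n. (\<exists>y. P (map (\<lambda>h. h n) gs) y) \<longrightarrow> P (map (\<lambda>h. h n) gs) (g n)"
    using exists_skolem_closure[OF countable_preds] by blast
  interpret internal_universe U F by unfold_locales (fact U F)+
  obtain u p q where upq: "\<And>i. condition (u i) (p i) (q i)"
    "\<And>i. refines (enum i) (u i) (p i) (q i) (u (Suc i)) (p (Suc i)) (q (Suc i))"
    "p 0 = id" "\<forall>\<^sub>F n in U. n \<le> u 0 n" using generic_sequence_exists by blast
  interpret generic_cut U F u p q by unfold_locales (fact upq)+
  obtain rep :: "nat \<Rightarrow> nat \<Rightarrow> nat" where rep: "\<And>i. rep i \<in> I" "\<And>i j. \<forall>\<^sub>F n in U. rep i n = rep j n \<Longrightarrow> i = j"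
    "\<And>f. f \<in> I \<Longrightarrow> \<exists>i. \<forall>\<^sub>F n in U. f n = rep i n" using representatives_exist by blast
  interpret cut_model U F u p q rep by unfold_locales (fact rep)+
  show ?thesis using derivable_sound model_of_WKL0 not_FinCOH_M by blast
qed

end
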